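(* Let $p:\mathbb{R}^n\to\mathbb{R}$ be a complete isometric hyperbolic polynomial of degree $d$ along $e\in\mathbb{R}^n$, let $\Lambda=\Lambda(p,e)$ be its hyperbolicity cone and let $x\in\mathbb{R}^n$. Then $$\operatorname{dist}(x,\Lambda)=\inf_{u\in\lambda(\Lambda)}\|\lambda(x)-u\|_2 .$$ In particular, if $\lambda(\Lambda)=\mathbb{R}^d_+\cap\mathbb{R}^d_{\downarrow}$ holds, then $$\operatorname{dist}(x,\Lambda)^2=\sum_{i=1}^d\min(\lambda_i(x),0)^2 .$$
   Context: A homogeneous polynomial $p:\mathbb{R}^n\to\mathbb{R}$ of degree $d$ is hyperbolic along $e\in\mathbb{R}^n$ if $p(e)\neq 0$ and, for every $x\in\mathbb{R}^n$, the univariate polynomial $t\mapsto p(x-te)$ has only real roots. Its $d$ roots (with multiplicity), ordered decreasingly $\lambda_1(x)\ge\cdots\ge\lambda_d(x)$, are the eigenvalues of $x$, and $\lambda(x)=(\lambda_1(x),\dots,\lambda_d(x))\in\mathbb{R}^d_{\downarrow}$, where $\mathbb{R}^d_{\downarrow}=\{u\in\mathbb{R}^d\mid u_1\ge\cdots\ge u_d\}$. For $S\subseteq\mathbb{R}^n$, $\lambda(S)=\{\lambda(x)\mid x\in S\}$. The hyperbolicity cone is the closed convex cone $\Lambda(p,e)=\{x\in\mathbb{R}^n\mid\lambda_d(x)\ge 0\}$. $\mathbb{R}^d_+$ is the nonnegative orthant. $p$ is complete if $\{x\mid\lambda(x)=0\}=\{0\}$. $p$ is isometric if for all $y,z\in\mathbb{R}^n$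 there exists $x\in\mathbb{R}^n$ with $\lambda(x)=\lambda(z)$ and $\lambda(x+y)=\lambda(x)+\lambda(y)$. For complete $p$, $\mathbb{R}^n$ is equipped with the norm $\|x\|_p=\|\lambda(x)\|_2$ (where $\|\cdot\|_2$ is the Euclidean norm on $\mathbb{R}^d$), which is induced by the inner product $\langle x,y\rangle_p=\frac14\|x+y\|_p^2-\frac14\|x-y\|_p^2$. For $S\subseteq\mathbb{R}^n$, $\operatorname{dist}(x,S)=\inf_{y\in S}\|x-y\|_p$. *)

theory Defs
  imports
    "HOL-Analysis.Analysis"
    "HOL-Computational_Algebra.Computational_Algebra"
begin

text \<open>
  Polynomials on \<open>\<real>\<^sup>n\<close> are real functions on \<^typ>\<open>real ^ 'n\<close>. A monomial is given by its
  exponent vector \<open>\<alpha> :: 'n \<Rightarrow> nat\<close>; only finitely many exponent vectors have total degree \<open>d\<close>.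
\<close>

definition homogeneous_polynomial :: "nat \<Rightarrow> (real ^ 'n \<Rightarrow> real) \<Rightarrow> bool" where
  "homogeneous_polynomial d p \<longleftrightarrow>
     (\<exists>c :: ('n \<Rightarrow> nat) \<Rightarrow> real.
        \<forall>x. p x = (\<Sum>\<alpha> | (\<Sum>j\<in>UNIV. \<alpha> j) = d. c \<alpha> * (\<Prod>j\<in>UNIV. x $ j ^ \<alpha> j)))"

text \<open>
  The univariate polynomial \<open>t \<mapsto> p (x - t e)\<close>. A real polynomial is determined by its
  values, so the description is unique whenever \<open>p\<close> is a polynomial function.
\<close>

definition line_poly :: "(real ^ 'n \<Rightarrow> real) \<Rightarrow> real ^ 'n \<Rightarrow> real ^ 'n \<Rightarrow> real poly" where
  "line_poly p e x = (THE q. \<forall>t. poly q t = p (x - t *\<^sub>R e))"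

definition hyperbolic_polynomial :: "nat \<Rightarrow> (real ^ 'n \<Rightarrow> real) \<Rightarrow> real ^ 'n \<Rightarrow> bool" where
  "hyperbolic_polynomial d p e \<longleftrightarrow>
     homogeneous_polynomial d p \<and> p e \<noteq> 0 \<and>
     (\<forall>x. \<forall>z :: complex. poly (map_poly complex_of_real (line_poly p e x)) z = 0 \<longrightarrow> z \<in> \<real>)"

text \<open>
  Vectors of \<open>\<real>\<^sup>d\<close> are functions \<open>u :: nat \<Rightarrow> real\<close> with coordinates \<open>u 1, \<dots>, u d\<close> and the value
  \<open>0\<close> at every other index, so that equality of functions is equality in \<open>\<real>\<^sup>d\<close>. The Euclidean
  norm of \<open>u\<close> is \<open>L2_set u {1..d}\<close>.
\<close>

definition vectors :: "nat \<Rightarrow> (nat \<Rightarrow> real) set" where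
  "vectors d = {u. \<forall>i. i \<notin> {1..d} \<longrightarrow> u i = 0}"

definition decreasing_vectors :: "nat \<Rightarrow> (nat \<Rightarrow> real) set" where
  "decreasing_vectors d = {u \<in> vectors d. antimono_on {1..d} u}"

definition nonneg_orthant :: "nat \<Rightarrow> (nat \<Rightarrow> real) set" where
  "nonneg_orthant d = {u \<in> vectors d. \<forall>i\<in>{1..d}. 0 \<le> u i}"

text \<open>
  \<^const>\<open>proots\<close> is the multiset of roots counted with multiplicity. If \<open>p\<close> is hyperbolic of
  degree \<open>d\<close> along \<open>e\<close>, then \<open>line_poly p e x\<close> has degree \<open>d\<close> (its coefficient at \<open>t\<^sup>d\<close> is
  \<open>(-1)\<^sup>d p(e)\<close>), so the list below has length \<open>d\<close>.
\<close>

definition eigenvalues ::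
    "nat \<Rightarrow> (real ^ 'n \<Rightarrow> real) \<Rightarrow> real ^ 'n \<Rightarrow> real ^ 'n \<Rightarrow> nat \<Rightarrow> real" where
  "eigenvalues d p e x =
     (\<lambda>i. if i \<in> {1..d}
          then rev (sorted_list_of_multiset (proots (line_poly p e x))) ! (i - 1) else 0)"

definition hyperbolicity_cone ::
    "nat \<Rightarrow> (real ^ 'n \<Rightarrow> real) \<Rightarrow> real ^ 'n \<Rightarrow> (real ^ 'n) set" where
  "hyperbolicity_cone d p e = {x. 0 \<le> eigenvalues d p e x d}"

definition complete_polynomial :: "nat \<Rightarrow> (real ^ 'n \<Rightarrow> real) \<Rightarrow> real ^ 'n \<Rightarrow> bool" where
  "complete_polynomial d p e \<longleftrightarrow> {x. eigenvalues d p e x = (\<lambda>i. 0)} = {0}"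

definition isometric_polynomial :: "nat \<Rightarrow> (real ^ 'n \<Rightarrow> real) \<Rightarrow> real ^ 'n \<Rightarrow> bool" where
  "isometric_polynomial d p e \<longleftrightarrow>
     (\<forall>y z. \<exists>x. eigenvalues d p e x = eigenvalues d p e z \<and>
        eigenvalues d p e (x + y) = (\<lambda>i. eigenvalues d p e x i + eigenvalues d p e y i))"

definition norm_p :: "nat \<Rightarrow> (real ^ 'n \<Rightarrow> real) \<Rightarrow> real ^ 'n \<Rightarrow> real ^ 'n \<Rightarrow> real" where
  "norm_p d p e x = L2_set (eigenvalues d p e x) {1..d}"

text \<open>
  The distance is taken in \<^const>\<open>norm_p\<close>, not in the Euclidean norm of \<^typ>\<open>real ^ 'n\<close>. The
  infimum is the conditionally complete one on \<open>\<real>\<close>, meaningful for nonempty \<open>S\<close>.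
\<close>

definition dist_p ::
    "nat \<Rightarrow> (real ^ 'n \<Rightarrow> real) \<Rightarrow> real ^ 'n \<Rightarrow> real ^ 'n \<Rightarrow> (real ^ 'n) set \<Rightarrow> real" where
  "dist_p d p e x S = (INF y\<in>S. norm_p d p e (x - y))"

end

theory Submission
  imports Defs "HOL-Combinatorics.Permutations"
begin

text \<open>
  In the norm \<open>\<parallel>x\<parallel> = \<parallel>\<lambda>(x)\<parallel>\<^sub>2\<close> the parallelogram law holds, since along a line the squared norm
  is the second power sum of the eigenvalues, a polynomial of degree at most two. Hence
  \<open>\<parallel>x - y\<parallel>\<^sup>2 - \<parallel>\<lambda>(x) - \<lambda>(y)\<parallel>\<^sup>2 = \<parallel>\<lambda>(x) + \<lambda>(y)\<parallel>\<^sup>2 - \<parallel>x + y\<parallel>\<^sup>2\<close>. The right-hand side is nonnegative,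
  because the sum of the \<open>k\<close> largest eigenvalues is subadditive and the sum of all eigenvalues is
  linear; so no point of the cone is closer to \<open>x\<close> than its eigenvalue vector is to \<open>\<lambda>(x)\<close>. It
  vanishes if \<open>\<lambda>(x + y) = \<lambda>(x) + \<lambda>(y)\<close>, and isometry provides such a \<open>y\<close> with any prescribed
  eigenvalue vector.

  Subadditivity is Garding's theorem applied to the hyperbolic polynomial whose eigenvalues are
  the sums of \<open>k\<close> eigenvalues. Only its restriction to a line \<open>s \<mapsto> x + s y\<close> is needed; its
  coefficients are polynomials in \<open>s\<close> because symmetric functions of the eigenvalues are.
\<close>

section \<open>Symmetric functions\<close>

text \<open>The logarithmic derivative of a product of factors \<open>1 - a i * X\<close> is minus
  the sum of the series \<open>a i / (1 - a i * X)\<close>, whose coefficients are the power sums.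
  Multiplying out avoids dividing power series.\<close>

lemma prod_one_minus_deriv:
  fixes a :: "'i \<Rightarrow> real"
  assumes "finite A"
  shows "(\<Prod>i\<in>A. 1 - fps_const (a i) * fps_X) * Abs_fps (\<lambda>n. \<Sum>i\<in>A. a i ^ Suc n)
    = - fps_deriv (\<Prod>i\<in>A. 1 - fps_const (a i) * fps_X)"
  using assms
proof (induction A rule: finite_induct)
  case empty
  then show ?case by (simp add: fps_eq_iff)
next
  case (insert j A)
  let ?R = "\<Prod>i\<in>A. 1 - fps_const (a i) * fps_X"
  let ?G = "Abs_fps (\<lambda>n. a j ^ Suc n)"
  let ?P = "Abs_fps (\<lambda>n. \<Sum>i\<in>A. a i ^ Suc n)"
  have split: "Abs_fps (\<lambda>n. \<Sum>i\<in>insert j A. a i ^ Suc n) = ?G + ?P"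
    using insert by (simp add: fps_eq_iff)
  have geo: "(1 - fps_const (a j) * fps_X) * ?G = fps_const (a j)"
  proof (rule fps_ext)
    fix n show "((1 - fps_const (a j) * fps_X) * ?G) $ n = fps_const (a j) $ n"
      by (cases n) (simp_all add: algebra_simps mult.assoc)
  qed
  have "(1 - fps_const (a j) * fps_X) * ?R * (?G + ?P)
      = ((1 - fps_const (a j) * fps_X) * ?G) * ?R + (1 - fps_const (a j) * fps_X) * (?R * ?P)"
    by (simp add: algebra_simps)
  also have "\<dots> = fps_const (a j) * ?R + (1 - fps_const (a j) * fps_X) * (- fps_deriv ?R)"
    by (simp only: geo insert.IH)
  also have "\<dots> = - fps_deriv ((1 - fps_const (a j) * fps_X) * ?R)"
    by (simp add: algebra_simps)
  finally show ?case
    using insert by (simp only: split prod.insert[OF insert.hyps])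
qed

text \<open>Compares coefficients in the preceding identity. The coefficients of the product are the
  elementary symmetric functions up to sign, and the summand \<open>k = 0\<close> contains the power
  sum of highest order, so the power sums can be computed recursively.\<close>

lemma newton_identity:
  fixes a :: "'i \<Rightarrow> real"
  assumes "finite A"
  shows "(\<Sum>k\<le>n. coeff (\<Prod>i\<in>A. [:1, - a i:]) k * (\<Sum>i\<in>A. a i ^ Suc (n - k)))
    = - (real (Suc n) * coeff (\<Prod>i\<in>A. [:1, - a i:]) (Suc n))"
proof -
  let ?p = "\<Prod>i\<in>A. [:1, - a i:]"
  have "fps_of_poly ?p = (\<Prod>i\<in>A. 1 - fps_const (a i) * fps_X)"
    by (simp add: fps_of_poly_prod fps_of_poly_pCons flip: fps_const_neg)
  with prod_one_minus_deriv[OF assms, of a]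
  have "fps_of_poly ?p * Abs_fps (\<lambda>n. \<Sum>i\<in>A. a i ^ Suc n) = - fps_deriv (fps_of_poly ?p)"
    by simp
  from arg_cong[OF this, of "\<lambda>f. f $ n"] show ?thesis
    by (simp add: fps_mult_nth atLeast0AtMost)
qed

section \<open>Monomials summed over injective index maps\<close>

definition injections :: "'i set \<Rightarrow> nat \<Rightarrow> ('i \<Rightarrow> nat) set" where
  "injections I d = {f \<in> I \<rightarrow>\<^sub>E {1..d}. inj_on f I}"

text \<open>A constant multiple of a monomial symmetric function. For \<open>I = {1..d}\<close> it
  is the monomial with exponents \<open>\<alpha>\<close> summed over all permutations of the
  variables.\<close>

definition injection_sum :: "nat \<Rightarrow> 'i set \<Rightarrow> ('i \<Rightarrow> nat) \<Rightarrow> (nat \<Rightarrow> real) \<Rightarrow> real" where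
  "injection_sum d I \<alpha> v = (\<Sum>f\<in>injections I d. \<Prod>i\<in>I. v (f i) ^ \<alpha> i)"

lemma finite_injections [simp]: "finite I \<Longrightarrow> finite (injections I d)"
  unfolding injections_def by (rule finite_subset[of _ "I \<rightarrow>\<^sub>E {1..d}"]) (auto intro: finite_PiE)

lemma bij_betw_injections_insert:
  assumes "j \<notin> I"
  shows "bij_betw (\<lambda>(f, c). f(j := c)) (SIGMA f:injections I d. {1..d} - f ` I)
    (injections (insert j I) d)"
proof (rule bij_betw_byWitness[where f' = "\<lambda>g. (g(j := undefined), g j)"])
  show "\<forall>x\<in>SIGMA f:injections I d. {1..d} - f ` I.
      (\<lambda>g. (g(j := undefined), g j)) (case x of (f, c) \<Rightarrow> f(j := c)) = x"
    using assms by (auto simp: injections_def PiE_def extensional_def)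
  show "\<forall>g\<in>injections (insert j I) d.
      (case (g(j := undefined), g j) of (f, c) \<Rightarrow> f(j := c)) = g"
    by auto
  show "(\<lambda>(f, c). f(j := c)) ` (SIGMA f:injections I d. {1..d} - f ` I)
      \<subseteq> injections (insert j I) d"
  proof clarify
    fix f c assume f: "f \<in> injections I d" and c: "c \<in> {1..d}" "c \<notin> f ` I"
    have "f(j := c) \<in> insert j I \<rightarrow>\<^sub>E {1..d}"
      using f c by (auto simp: injections_def PiE_def extensional_def)
    moreover have "inj_on (f(j := c)) (insert j I)"
      using f c assms by (auto simp: injections_def inj_on_def)
    ultimately show "f(j := c) \<in> injections (insert j I) d"
      by (simp add: injections_def)
  qed
  show "(\<lambda>g. (g(j := undefined), g j)) ` injections (insert j I) d
      \<subseteq> (SIGMA f:injections I d. {1..d} - f ` I)"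
  proof clarify
    fix g assume g: "g \<in> injections (insert j I) d"
    then have 1: "g(j := undefined) \<in> I \<rightarrow>\<^sub>E {1..d}"
      using assms by (auto simp: injections_def PiE_def extensional_def Pi_def)
    have 2: "inj_on (g(j := undefined)) I"
      using g assms by (auto simp: injections_def inj_on_def)
    have 3: "g j \<in> {1..d}" using g by (auto simp: injections_def)
    have 4: "g j \<notin> (g(j := undefined)) ` I"
      using g assms by (auto simp: injections_def)
    from 1 2 3 4 show "g(j := undefined) \<in> injections I d \<and>
        g j \<in> {1..d} - (g(j := undefined)) ` I"
      by (simp add: injections_def)
  qed
qed

text \<open>The value \<open>c\<close> of the new index \<open>j\<close> first ranges over all of
  \<open>{1..d}\<close>, which gives a power sum. The choices \<open>c = f i\<close> must then be
  removed; there the two powers of \<open>v (f i)\<close> merge into one with exponent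
  \<open>\<alpha> i + \<alpha> j\<close>. Iteration reduces every injection sum to power
  sums.\<close>

lemma injection_sum_insert:
  assumes "finite I" "j \<notin> I"
  shows "injection_sum d (insert j I) \<alpha> v
    = injection_sum d I \<alpha> v * (\<Sum>c\<in>{1..d}. v c ^ \<alpha> j)
      - (\<Sum>i\<in>I. injection_sum d I (\<alpha>(i := \<alpha> i + \<alpha> j)) v)"
proof -
  have "injection_sum d (insert j I) \<alpha> v
      = (\<Sum>(f, c)\<in>(SIGMA f:injections I d. {1..d} - f ` I).
           \<Prod>i\<in>insert j I. v ((f(j := c)) i) ^ \<alpha> i)"
    unfolding injection_sum_def
    by (subst sum.reindex_bij_betw[OF bij_betw_injections_insert[OF assms(2)], symmetric])
       (simp add: case_prod_unfold)
  also have "\<dots> = (\<Sum>(f, c)\<in>(SIGMA f:injections I d. {1..d} - f ` I).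
        (\<Prod>i\<in>I. v (f i) ^ \<alpha> i) * v c ^ \<alpha> j)"
  proof (rule sum.cong[OF refl], clarify)
    fix f c
    have "(\<Prod>i\<in>I. v ((f(j := c)) i) ^ \<alpha> i) = (\<Prod>i\<in>I. v (f i) ^ \<alpha> i)"
      using assms(2) by (intro prod.cong) auto
    then show "(\<Prod>i\<in>insert j I. v ((f(j := c)) i) ^ \<alpha> i) = (\<Prod>i\<in>I. v (f i) ^ \<alpha> i) * v c ^ \<alpha> j"
      using assms by simp
  qed
  also have "\<dots> = (\<Sum>f\<in>injections I d. \<Sum>c\<in>{1..d} - f ` I. (\<Prod>i\<in>I. v (f i) ^ \<alpha> i) * v c ^ \<alpha> j)"
    using assms(1) by (subst sum.Sigma) auto
  also have "\<dots> = (\<Sum>f\<in>injections I d. (\<Prod>i\<in>I. v (f i) ^ \<alpha> i) * (\<Sum>c\<in>{1..d}. v c ^ \<alpha> j)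
      - (\<Sum>i\<in>I. \<Prod>l\<in>I. v (f l) ^ (\<alpha>(i := \<alpha> i + \<alpha> j)) l))"
  proof (rule sum.cong[OF refl])
    fix f assume f: "f \<in> injections I d"
    have sub: "f ` I \<subseteq> {1..d}" and inj: "inj_on f I"
      using f unfolding injections_def by blast+
    have "(\<Sum>c\<in>{1..d} - f ` I. v c ^ \<alpha> j) = (\<Sum>c\<in>{1..d}. v c ^ \<alpha> j) - (\<Sum>i\<in>I. v (f i) ^ \<alpha> j)"
      by (subst sum_diff) (simp_all add: sub sum.reindex[OF inj] del: One_nat_def)
    moreover have "(\<Prod>l\<in>I. v (f l) ^ (\<alpha>(i := \<alpha> i + \<alpha> j)) l) = (\<Prod>l\<in>I. v (f l) ^ \<alpha> l) * v (f i) ^ \<alpha> j"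
      if "i \<in> I" for i
    proof -
      have "(\<Prod>l\<in>I - {i}. v (f l) ^ (\<alpha>(i := \<alpha> i + \<alpha> j)) l) = (\<Prod>l\<in>I - {i}. v (f l) ^ \<alpha> l)"
        by (intro prod.cong) auto
      then show ?thesis
        using assms(1) that by (simp add: prod.remove[of I i] power_add)
    qed
    ultimately show "(\<Sum>c\<in>{1..d} - f ` I. (\<Prod>i\<in>I. v (f i) ^ \<alpha> i) * v c ^ \<alpha> j)
        = (\<Prod>i\<in>I. v (f i) ^ \<alpha> i) * (\<Sum>c\<in>{1..d}. v c ^ \<alpha> j)
          - (\<Sum>i\<in>I. \<Prod>l\<in>I. v (f l) ^ (\<alpha>(i := \<alpha> i + \<alpha> j)) l)"
      by (simp add: sum_distrib_left[symmetric] right_diff_distrib)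
  qed
  also have "\<dots> = injection_sum d I \<alpha> v * (\<Sum>c\<in>{1..d}. v c ^ \<alpha> j)
      - (\<Sum>i\<in>I. injection_sum d I (\<alpha>(i := \<alpha> i + \<alpha> j)) v)"
    unfolding injection_sum_def
    by (simp add: sum_subtractf sum_distrib_right sum.swap[of _ I])
  finally show ?thesis .
qed

section \<open>Polynomial functions of a vector and a parameter\<close>

definition symmetric_in :: "nat \<Rightarrow> ((nat \<Rightarrow> real) \<Rightarrow> 'a) \<Rightarrow> bool" where
  "symmetric_in d F \<longleftrightarrow> (\<forall>f v. f permutes {1..d} \<longrightarrow> F (v \<circ> f) = F v)"

text \<open>These are the polynomials in \<open>v 1\<close>, ..., \<open>v d\<close> with
  coefficients polynomial in \<open>s\<close>. A list of terms, possibly with repeated exponents,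
  makes sums a matter of appending lists.\<close>

definition poly_fun :: "nat \<Rightarrow> ((nat \<Rightarrow> real) \<Rightarrow> real \<Rightarrow> real) \<Rightarrow> bool" where
  "poly_fun d F \<longleftrightarrow> (\<exists>M :: (real poly \<times> (nat \<Rightarrow> nat)) list.
     \<forall>v s. F v s = (\<Sum>(a, \<alpha>)\<leftarrow>M. poly a s * (\<Prod>i\<in>{1..d}. v i ^ \<alpha> i)))"

lemma poly_fun_poly: "poly_fun d (\<lambda>v s. poly a s)"
  unfolding poly_fun_def by (rule exI[of _ "[(a, \<lambda>_. 0)]"]) simp

lemma poly_fun_const: "poly_fun d (\<lambda>v s. c)"
  using poly_fun_poly[of d "[:c:]"] by simp

lemma poly_fun_var: "i \<in> {1..d} \<Longrightarrow> poly_fun d (\<lambda>v s. v i)"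
  unfolding poly_fun_def
  by (rule exI[of _ "[(1, \<lambda>j. if j = i then 1 else 0)]"]) (simp add: if_distrib prod.delta cong: if_cong)

lemma poly_fun_add:
  assumes "poly_fun d F" "poly_fun d G"
  shows "poly_fun d (\<lambda>v s. F v s + G v s)"
proof -
  obtain M N where "\<forall>v s. F v s = (\<Sum>(a, \<alpha>)\<leftarrow>M. poly a s * (\<Prod>i\<in>{1..d}. v i ^ \<alpha> i))"
    "\<forall>v s. G v s = (\<Sum>(a, \<alpha>)\<leftarrow>N. poly a s * (\<Prod>i\<in>{1..d}. v i ^ \<alpha> i))"
    using assms unfolding poly_fun_def by blast
  then show ?thesis
    unfolding poly_fun_def by (intro exI[of _ "M @ N"]) simp
qed

lemma poly_fun_mult:
  assumes "poly_fun d F" "poly_fun d G"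
  shows "poly_fun d (\<lambda>v s. F v s * G v s)"
proof -
  obtain M N where M: "\<forall>v s. F v s = (\<Sum>(a, \<alpha>)\<leftarrow>M. poly a s * (\<Prod>i\<in>{1..d}. v i ^ \<alpha> i))"
    and N: "\<forall>v s. G v s = (\<Sum>(a, \<alpha>)\<leftarrow>N. poly a s * (\<Prod>i\<in>{1..d}. v i ^ \<alpha> i))"
    using assms unfolding poly_fun_def by blast
  have mono: "poly_fun d (\<lambda>v s. poly a s * (\<Prod>i\<in>{1..d}. v i ^ \<alpha> i) * G v s)" for a \<alpha>
    unfolding poly_fun_def
    by (rule exI[of _ "map (\<lambda>(b, \<beta>). (a * b, \<lambda>i. \<alpha> i + \<beta> i)) N"])
       (simp add: N o_def case_prod_unfold power_add prod.distrib sum_list_const_mult mult_ac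
          flip: sum_list_const_mult)
  have "poly_fun d (\<lambda>v s. (\<Sum>(a, \<alpha>)\<leftarrow>M. poly a s * (\<Prod>i\<in>{1..d}. v i ^ \<alpha> i)) * G v s)"
  proof (induction M)
    case Nil
    then show ?case using poly_fun_const[of d 0] by simp
  next
    case (Cons m M)
    then show ?case
      using poly_fun_add[OF mono[of "fst m" "snd m"] Cons]
      by (simp add: case_prod_unfold distrib_right)
  qed
  with M show ?thesis by simp
qed

lemma poly_fun_diff:
  assumes "poly_fun d F" "poly_fun d G"
  shows "poly_fun d (\<lambda>v s. F v s - G v s)"
  using poly_fun_add[OF assms(1) poly_fun_mult[OF poly_fun_const[of d "-1"] assms(2)]] by simp

lemma poly_fun_sum:
  "(\<And>j. j \<in> J \<Longrightarrow> poly_fun d (F j)) \<Longrightarrow> poly_fun d (\<lambda>v s. \<Sum>j\<in>J. F j v s)"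
  by (induction J rule: infinite_finite_induct) (auto intro: poly_fun_const poly_fun_add)

lemma poly_fun_prod:
  "(\<And>j. j \<in> J \<Longrightarrow> poly_fun d (F j)) \<Longrightarrow> poly_fun d (\<lambda>v s. \<Prod>j\<in>J. F j v s)"
  by (induction J rule: infinite_finite_induct) (auto intro: poly_fun_const poly_fun_mult)

lemma poly_fun_power: "poly_fun d F \<Longrightarrow> poly_fun d (\<lambda>v s. F v s ^ n)"
  by (induction n) (auto intro: poly_fun_const poly_fun_mult)

lemmas poly_fun_intros = poly_fun_poly poly_fun_const poly_fun_var poly_fun_add poly_fun_mult
  poly_fun_diff poly_fun_sum poly_fun_prod poly_fun_power

section \<open>Pencils of real-rooted polynomials\<close>

text \<open>After splitting off one factor \<open>s - c\<close>, the cofactor is nonnegative to the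
  right of \<open>c\<close> and nonpositive to the left, so by continuity it vanishes at
  \<open>c\<close> as well.\<close>

lemma nonneg_poly_double_root:
  fixes P :: "real poly"
  assumes nonneg: "\<And>s. 0 \<le> poly P s" and root: "poly P c = 0"
  obtains Q where "P = [:- c, 1:]\<^sup>2 * Q"
proof -
  obtain Q where Q: "P = [:- c, 1:] * Q"
    using root by (auto simp: poly_eq_0_iff_dvd dvd_def)
  have "poly Q c = 0"
  proof -
    have nonneg: "0 \<le> (s - c) * poly Q s" for s
      using nonneg[of s] by (simp add: Q algebra_simps)
    have "0 \<le> poly Q s" if "c < s" for s
      using nonneg[of s] that by (simp add: zero_le_mult_iff)
    moreover have "poly Q s \<le> 0" if "s < c" for s
      using nonneg[of s] that by (simp add: zero_le_mult_iff)
    moreover have "(poly Q \<longlongrightarrow> poly Q c) (at c)"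
      using poly_isCont isCont_def by blast
    then have "(poly Q \<longlongrightarrow> poly Q c) (at_right c)" "(poly Q \<longlongrightarrow> poly Q c) (at_left c)"
      by (auto simp: filterlim_at_split)
    ultimately have "0 \<le> poly Q c" "poly Q c \<le> 0"
      using tendsto_lowerbound[of "poly Q" "poly Q c" "at_right c" 0]
        tendsto_upperbound[of "poly Q" "poly Q c" "at_left c" 0]
      by (auto simp: eventually_at_filter)
    then show ?thesis by simp
  qed
  then obtain Q' where "Q = [:- c, 1:] * Q'"
    by (auto simp: poly_eq_0_iff_dvd dvd_def)
  with Q show ?thesis by (intro that[of Q']) (simp only: power2_eq_square mult.assoc)
qed

text \<open>A pigeonhole argument: \<open>f\<close> cannot map \<open>{i..d}\<close> into the
  smaller set \<open>{Suc i..d}\<close>, nor \<open>{1..i}\<close> into \<open>{1..<i}\<close>. In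
  either case the resulting \<open>j\<close> has a gap at least as wide as that at \<open>i\<close>,
  by monotonicity. Hence matching decreasing vectors in order is optimal for the largest coordinate
  difference.\<close>

lemma antimono_permuted_distance:
  fixes u a :: "nat \<Rightarrow> real"
  assumes u: "antimono_on {1..d} u" and a: "antimono_on {1..d} a"
    and f: "f permutes {1..d}" and i: "i \<in> {1..d}"
  obtains j where "j \<in> {1..d}" "\<bar>u i - a i\<bar> \<le> \<bar>u (f j) - a j\<bar>"
proof -
  have inj: "inj_on f A" for A using f permutes_inj inj_on_subset by blast
  have range: "f j \<in> {1..d}" if "j \<in> {1..d}" for j using f that permutes_in_image by fastforce
  show ?thesis
  proof (cases "a i \<le> u i")
    case True
    have "\<exists>j\<in>{i..d}. f j \<le> i"
    proof (rule ccontr)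
      assume "\<not> ?thesis"
      then have "f ` {i..d} \<subseteq> {Suc i..d}" using range i by (fastforce simp: image_subset_iff not_le Suc_le_eq)
      then have "card (f ` {i..d}) \<le> card {Suc i..d}" by (intro card_mono) auto
      then show False using i by (auto simp: card_image[OF inj])
    qed
    then obtain j where j: "j \<in> {i..d}" "f j \<le> i" by blast
    then have "u i \<le> u (f j)" "a j \<le> a i"
      using i range[of j] monotone_onD[OF u, of "f j" i] monotone_onD[OF a, of i j] by auto
    then show ?thesis using True j i by (intro that[of j]) auto
  next
    case False
    have "\<exists>j\<in>{1..i}. i \<le> f j"
    proof (rule ccontr)
      assume "\<not> ?thesis"
      then have "f ` {1..i} \<subseteq> {1..<i}" using range i by (fastforce simp: image_subset_iff not_le)
      then have "card (f ` {1..i}) \<le> card {1..<i}" by (intro card_mono) auto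
      then show False using i by (auto simp: card_image[OF inj])
    qed
    then obtain j where j: "j \<in> {1..i}" "i \<le> f j" by blast
    then have "u (f j) \<le> u i" "a i \<le> a j"
      using i range[of j] monotone_onD[OF u, of i "f j"] monotone_onD[OF a, of j i] by auto
    then show ?thesis using False j i by (intro that[of j]) auto
  qed
qed

text \<open>\<open>R\<close> is a polynomial in \<open>u\<close> whose coefficients are polynomials
  in \<open>s\<close>; the inner \<open>poly\<close> inserts the constant polynomial
  \<open>u\<close>. The reversed factors \<open>1 - u * L s i\<close> are those of Newton's
  identities and give \<open>R\<close> the constant coefficient 1.\<close>

locale pencil =
  fixes d :: nat and L :: "real \<Rightarrow> nat \<Rightarrow> real" and R :: "real poly poly"
  assumes antimono: "antimono_on {1..d} (L s)"
    and R: "(\<Prod>i\<in>{1..d}. 1 - u * L s i) = poly (poly R [:u:]) s"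
begin

lemma coeff_R: "coeff (\<Prod>i\<in>{1..d}. [:1, - L s i:]) k = poly (coeff R k) s"
proof -
  have "(\<Prod>i\<in>{1..d}. [:1, - L s i:]) = map_poly (\<lambda>q. poly q s) R"
  proof -
    have "poly (\<Prod>i\<in>{1..d}. [:1, - L s i:]) u = poly (map_poly (\<lambda>q. poly q s) R) u" for u
    proof -
    have "poly (poly R [:u:]) s = poly (map_poly (\<lambda>q. poly q s) R) u"
      by (induction R) (simp_all add: map_poly_pCons)
    then show ?thesis
      using R[of u s] by (simp add: poly_prod)
    qed
    then show ?thesis by (simp add: poly_eq_poly_eq_iff[symmetric] fun_eq_iff)
  qed
  then show ?thesis by (simp add: coeff_map_poly)
qed


lemma power_sum_poly: "\<exists>P. \<forall>s. (\<Sum>i\<in>{1..d}. L s i ^ n) = poly P s"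
proof (induction n rule: less_induct)
  case (less n)
  show ?case
  proof (cases n)
    case 0
    then show ?thesis by (intro exI[of _ "[:real d:]"]) simp
  next
    case (Suc m)
    let ?p = "\<lambda>s n. \<Sum>i\<in>{1..d}. L s i ^ n"
    obtain P where P: "\<And>k s. k < n \<Longrightarrow> ?p s k = poly (P k) s"
      using less.IH by metis
    \<comment> \<open>Newton's identity solved for the power sum of order \<open>Suc m\<close>. For
      \<open>k\<close> in \<open>{1..m}\<close> the order \<open>Suc (m - k)\<close> is below
      \<open>n\<close>, so the induction hypothesis supplies \<open>P\<close>.\<close>
    let ?N = "- (smult (real (Suc m)) (coeff R (Suc m)))
      - (\<Sum>k\<in>{1..m}. coeff R k * P (Suc (m - k)))"
    have "?p s n = poly ?N s" for s
    proof -
      have "{..m} = insert 0 {1..m}" by auto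
      then have "(\<Sum>k\<le>m. poly (coeff R k) s * ?p s (Suc (m - k)))
          = poly (coeff R 0) s * ?p s (Suc m) + (\<Sum>k\<in>{1..m}. poly (coeff R k) s * ?p s (Suc (m - k)))"
        by simp
      moreover have "(\<Sum>k\<in>{1..m}. poly (coeff R k) s * ?p s (Suc (m - k)))
          = (\<Sum>k\<in>{1..m}. poly (coeff R k * P (Suc (m - k))) s)"
        using Suc by (intro sum.cong) (auto simp: P simp del: power_Suc One_nat_def)
      moreover have "poly (coeff R 0) s = 1"
        using R[of 0 s] by (simp add: poly_0_coeff_0)
      ultimately show ?thesis
        using newton_identity[of "{1..d}" "L s" m] Suc by (simp add: coeff_R poly_sum del: One_nat_def)
    qed
    then show ?thesis by blast
  qed
qed

text \<open>Induction along \<open>injection_sum_insert\<close>; the exponents are generalised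
  because the recursion changes them.\<close>

lemma injection_sum_poly:
  assumes "finite I"
  shows "\<exists>P. \<forall>s. injection_sum d I \<alpha> (L s) = poly P s"
  using assms
proof (induction I arbitrary: \<alpha> rule: finite_induct)
  case empty
  have "injections ({} :: 'a set) d = {\<lambda>_. undefined}"
    by (auto simp: injections_def)
  then show ?case by (intro exI[of _ 1]) (simp add: injection_sum_def)
next
  case (insert j I)
  obtain P where P: "\<And>\<alpha> s. injection_sum d I \<alpha> (L s) = poly (P \<alpha>) s"
    using insert.IH by metis
  obtain p where p: "\<And>s. (\<Sum>c\<in>{1..d}. L s c ^ \<alpha> j) = poly p s"
    using power_sum_poly by blast
  show ?case
    by (rule exI[of _ "P \<alpha> * p - (\<Sum>i\<in>I. P (\<alpha>(i := \<alpha> i + \<alpha> j)))"])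
       (simp add: injection_sum_insert[OF insert.hyps] P p poly_sum del: One_nat_def)
qed

text \<open>A substitute for the fundamental theorem on symmetric polynomials: averaging a symmetric
  \<open>F\<close> over all injections of \<open>{1..d}\<close> into itself leaves it unchanged, but
  turns each monomial into an injection sum, which is already known to be polynomial in
  \<open>s\<close>.\<close>

lemma symmetric_poly_fun_poly:
  assumes F: "poly_fun d F" and sym: "symmetric_in d F"
  shows "\<exists>P. \<forall>s. F (L s) s = poly P s"
proof -
  obtain M where M: "\<And>v s. F v s = (\<Sum>(a, \<alpha>)\<leftarrow>M. poly a s * (\<Prod>i\<in>{1..d}. v i ^ \<alpha> i))"
    using F unfolding poly_fun_def by blast
  let ?J = "injections {1..d} d"
  have inv: "F (v \<circ> f) s = F v s" if f: "f \<in> ?J" for f v s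
  proof -
    \<comment> \<open>Elements of \<open>injections\<close> are \<open>undefined\<close> outside
      \<open>{1..d}\<close>; replacing that default by the identity makes \<open>f\<close> a
      permutation in the sense of \<open>permutes\<close>.\<close>
    let ?g = "\<lambda>i. if i \<in> {1..d} then f i else i"
    have "inj_on f {1..d}" "f ` {1..d} \<subseteq> {1..d}"
      using f unfolding injections_def by blast+
    then have "bij_betw f {1..d} {1..d}"
      by (simp add: bij_betw_def endo_inj_surj del: One_nat_def)
    moreover have "bij_betw ?g {1..d} {1..d} \<longleftrightarrow> bij_betw f {1..d} {1..d}"
      by (rule bij_betw_cong) simp
    ultimately have "bij_betw ?g {1..d} {1..d}" by simp
    then have "?g permutes {1..d}"
      by (rule bij_imp_permutes) auto
    then have "F (v \<circ> ?g) = F v"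
      using sym unfolding symmetric_in_def by blast
    moreover have "F (v \<circ> ?g) s = F (v \<circ> f) s"
      unfolding M by (intro arg_cong[of _ _ sum_list] map_cong) (auto intro!: prod.cong)
    ultimately show ?thesis by simp
  qed
  have "restrict id {1..d} \<in> ?J" by (auto simp: injections_def)
  then have card: "card ?J \<noteq> 0" using finite_injections[of "{1..d}" d] by auto
  obtain T where T: "\<And>\<alpha> s. injection_sum d {1..d} \<alpha> (L s) = poly (T \<alpha>) s"
    using injection_sum_poly[of "{1..d}"] by (metis finite_atLeastAtMost)
  have "F (L s) s = poly (smult (1 / real (card ?J)) (\<Sum>(a, \<alpha>)\<leftarrow>M. a * T \<alpha>)) s" for s
  proof -
    have "real (card ?J) * F (L s) s = (\<Sum>f\<in>?J. F (L s \<circ> f) s)"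
      by (simp add: inv)
    also have "\<dots> = (\<Sum>(a, \<alpha>)\<leftarrow>M. poly a s * injection_sum d {1..d} \<alpha> (L s))"
      unfolding M injection_sum_def
      by (induction M) (auto simp: sum.distrib sum_distrib_left)
    also have "\<dots> = poly (\<Sum>(a, \<alpha>)\<leftarrow>M. a * T \<alpha>) s"
      by (induction M) (auto simp: T simp del: One_nat_def)
    finally show ?thesis using card by (simp add: field_simps)
  qed
  then show ?thesis by blast
qed

text \<open>For each permutation \<open>f\<close>, take the squared distance between the permuted
  vector \<open>L s\<close> and \<open>L s0\<close>. The product over all \<open>f\<close> is
  symmetric, hence a polynomial in \<open>s\<close>, and vanishes at \<open>s0\<close> because of
  the identity. By \<open>antimono_permuted_distance\<close> each factor is at least
  \<open>(L s i - L s0 i)^2\<close>, so a power of the latter tends to 0.\<close>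

lemma continuous_L:
  assumes i: "i \<in> {1..d}"
  shows "continuous_on UNIV (\<lambda>s. L s i)"
proof -
  have "((\<lambda>s. L s i) \<longlongrightarrow> L s0 i) (at s0)" for s0
  proof -
    let ?a = "L s0" and ?\<Pi> = "{f. f permutes {1..d}}"
    let ?F = "\<lambda>v (s::real). \<Prod>f\<in>?\<Pi>. \<Sum>j\<in>{1..d}. (v (f j) - ?a j)\<^sup>2"
    have fin: "finite ?\<Pi>" by (simp add: finite_permutations)
    have "poly_fun d ?F"
      by (intro poly_fun_intros) (use permutes_in_image in fastforce)
    moreover have "symmetric_in d ?F"
      unfolding symmetric_in_def
    proof (intro allI impI ext)
      fix g v and s :: real assume g: "g permutes {1..d}"
      have "bij_betw (\<lambda>f. g \<circ> f) ?\<Pi> ?\<Pi>"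
        using g by (intro bij_betw_byWitness[where f' = "\<lambda>f. inv g \<circ> f"])
          (auto simp: permutes_compose permutes_inv permutes_inv_o o_assoc)
      from prod.reindex_bij_betw[OF this, of "\<lambda>f. \<Sum>j\<in>{1..d}. (v (f j) - ?a j)\<^sup>2"]
      show "?F (v \<circ> g) s = ?F v s" by simp
    qed
    ultimately obtain P where P: "\<And>s. ?F (L s) s = poly P s"
      using symmetric_poly_fun_poly[of ?F] by blast
    have "?F ?a s0 = 0"
      by (intro prod_zero[OF fin] bexI[of _ id]) (auto simp: permutes_id)
    then have "poly P s0 = 0" by (simp only: P)
    moreover have "(poly P \<longlongrightarrow> poly P s0) (at s0)"
      using poly_isCont isCont_def by blast
    ultimately have lim: "(poly P \<longlongrightarrow> 0) (at s0)" by simp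
    have le: "((L s i - ?a i)\<^sup>2) ^ card ?\<Pi> \<le> poly P s" for s
    proof -
      have "(L s i - ?a i)\<^sup>2 \<le> (\<Sum>j\<in>{1..d}. (L s (f j) - ?a j)\<^sup>2)" if f: "f \<in> ?\<Pi>" for f
      proof -
        obtain j where j: "j \<in> {1..d}" "\<bar>L s i - ?a i\<bar> \<le> \<bar>L s (f j) - ?a j\<bar>"
          using antimono_permuted_distance[OF antimono antimono _ i] f by blast
        then have "(L s i - ?a i)\<^sup>2 \<le> (L s (f j) - ?a j)\<^sup>2" by (simp add: abs_le_square_iff)
        also have "\<dots> \<le> (\<Sum>j\<in>{1..d}. (L s (f j) - ?a j)\<^sup>2)"
          using j(1) by (intro member_le_sum) auto
        finally show ?thesis .
      qed
      then have "(\<Prod>f\<in>?\<Pi>. (L s i - ?a i)\<^sup>2) \<le> ?F (L s) s"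
        by (intro prod_mono) auto
      then show ?thesis by (simp only: P prod_constant)
    qed
    have pos: "card ?\<Pi> > 0" using fin by (auto simp: card_gt_0_iff intro!: exI[of _ id] permutes_id)
    have "((\<lambda>s. ((L s i - ?a i)\<^sup>2) ^ card ?\<Pi>) \<longlongrightarrow> 0) (at s0)"
      by (rule tendsto_sandwich[OF _ _ tendsto_const lim]) (auto simp: le simp del: One_nat_def)
    then have "((\<lambda>s. root (2 * card ?\<Pi>) (((L s i - ?a i)\<^sup>2) ^ card ?\<Pi>)) \<longlongrightarrow> root (2 * card ?\<Pi>) 0) (at s0)"
      by (rule tendsto_real_root)
    moreover have "root (2 * card ?\<Pi>) (((L s i - ?a i)\<^sup>2) ^ card ?\<Pi>) = \<bar>L s i - ?a i\<bar>" for s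
    proof -
      have "((L s i - ?a i)\<^sup>2) ^ card ?\<Pi> = \<bar>L s i - ?a i\<bar> ^ (2 * card ?\<Pi>)"
        by (simp add: power_mult)
      then show ?thesis using pos by (simp add: real_root_power_cancel del: power_abs)
    qed
    ultimately have "((\<lambda>s. \<bar>L s i - ?a i\<bar>) \<longlongrightarrow> 0) (at s0)" by simp
    then show ?thesis
      by (simp add: tendsto_rabs_zero_iff LIM_zero_iff)
  qed
  then show ?thesis by (simp add: continuous_on_def)
qed

text \<open>
  The idea is to symmetrise the square of \<open>(L s i - a) \<Prod>\<^sub>j (L s j - a)\<close>, where \<open>a = L s\<^sub>0 i\<close> and \<open>j\<close>
  ranges over the indices with \<open>L s\<^sub>0 j \<noteq> a\<close>. The result is a nonnegative polynomial in \<open>s\<close> that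
  vanishes at \<open>s\<^sub>0\<close>, hence to second order.
\<close>

lemma locally_Lipschitz_L:
  assumes i: "i \<in> {1..d}"
  obtains C where "\<forall>\<^sub>F s in at s0. \<bar>L s i - L s0 i\<bar> \<le> C * \<bar>s - s0\<bar>"
proof -
  let ?a = "L s0" and ?\<Pi> = "{f. f permutes {1..d}}"
  let ?J = "{j \<in> {1..d}. ?a j \<noteq> ?a i}"
  let ?G = "\<lambda>(v :: nat \<Rightarrow> real) f. (v (f i) - ?a i)\<^sup>2 * (\<Prod>j\<in>?J. (v (f j) - ?a i)\<^sup>2)"
  let ?F = "\<lambda>v (s::real). \<Sum>f\<in>?\<Pi>. ?G v f"
  have fin: "finite ?\<Pi>" by (simp add: finite_permutations)
  have "poly_fun d ?F"
    using i by (intro poly_fun_intros) (simp_all add: permutes_in_image del: atLeastAtMost_iff One_nat_def)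
  moreover have "symmetric_in d ?F"
    unfolding symmetric_in_def
  proof (intro allI impI ext)
    fix g v and s :: real assume g: "g permutes {1..d}"
    have "bij_betw (\<lambda>f. g \<circ> f) ?\<Pi> ?\<Pi>"
      using g by (intro bij_betw_byWitness[where f' = "\<lambda>f. inv g \<circ> f"])
        (auto simp: permutes_compose permutes_inv permutes_inv_o o_assoc)
    from sum.reindex_bij_betw[OF this, of "?G v"]
    show "?F (v \<circ> g) s = ?F v s" by simp
  qed
  ultimately obtain P where P: "\<And>s. ?F (L s) s = poly P s"
    using symmetric_poly_fun_poly[of ?F] by blast
  have nonneg: "0 \<le> ?G v f" for v f by (intro mult_nonneg_nonneg prod_nonneg) auto
  have "?G ?a f = 0" if f: "f permutes {1..d}" for f
  proof -
    \<comment> \<open>Since \<open>i\<close> is not in \<open>?J\<close>, the set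
      \<open>insert i ?J\<close> has one element too many to be mapped into \<open>?J\<close>. An
      index leaving \<open>?J\<close> is sent to a coordinate equal to \<open>?a i\<close>, which
      makes a factor of \<open>?G\<close> vanish.\<close>
    have "card (f ` insert i ?J) = Suc (card ?J)"
      using card_image[OF inj_on_subset[OF permutes_inj[OF f]], of "insert i ?J"] by simp
    then have "\<not> f ` insert i ?J \<subseteq> ?J"
      using card_mono[of ?J "f ` insert i ?J"] by auto
    then obtain j where "j \<in> insert i ?J" "f j \<notin> ?J" by auto
    moreover from this have "f j \<in> {1..d}" using f i permutes_in_image by fastforce
    ultimately have "j \<in> insert i ?J" "?a (f j) = ?a i" by auto
    then show ?thesis by (auto simp: prod_zero_iff)
  qed
  then have "poly P s0 = 0" unfolding P[symmetric] by (intro sum.neutral) blast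
  moreover have "0 \<le> poly P s" for s
    by (subst P[symmetric]) (intro sum_nonneg nonneg)
  ultimately obtain Q where Q: "P = [:- s0, 1:]\<^sup>2 * Q"
    by (metis nonneg_poly_double_root)
  \<comment> \<open>The limit at \<open>s0\<close> of the auxiliary factors. It is positive, so near
    \<open>s0\<close> these factors can be divided out.\<close>
  define \<kappa> where "\<kappa> = (\<Prod>j\<in>?J. (?a j - ?a i)\<^sup>2)"
  have \<kappa>: "0 < \<kappa>" unfolding \<kappa>_def by (intro prod_pos) auto
  have "((\<lambda>s. \<Prod>j\<in>?J. (L s j - ?a i)\<^sup>2) \<longlongrightarrow> \<kappa>) (at s0)"
    unfolding \<kappa>_def
    using continuous_L by (intro tendsto_intros) (auto simp: continuous_on_def)
  then have ev1: "\<forall>\<^sub>F s in at s0. \<kappa> / 2 < (\<Prod>j\<in>?J. (L s j - ?a i)\<^sup>2)"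
    using \<kappa> by (intro order_tendstoD) auto
  define B where "B = \<bar>poly Q s0\<bar> + 1"
  have "(poly Q \<longlongrightarrow> poly Q s0) (at s0)" using poly_isCont isCont_def by blast
  then have ev2: "\<forall>\<^sub>F s in at s0. poly Q s < B"
    by (rule order_tendstoD) (simp add: B_def)
  have "\<forall>\<^sub>F s in at s0. \<bar>L s i - ?a i\<bar> \<le> sqrt (2 * B / \<kappa>) * \<bar>s - s0\<bar>"
    using ev1 ev2
  proof eventually_elim
    case (elim s)
    \<comment> \<open>The summand of the identity permutation is bounded by the whole sum, as all
      summands are nonnegative.\<close>
    have "(L s i - ?a i)\<^sup>2 * (\<kappa> / 2) \<le> ?G (L s) id"
      unfolding id_apply using elim by (intro mult_left_mono) auto
    also have "\<dots> \<le> poly P s"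
      unfolding P[symmetric] using fin nonneg
      by (intro member_le_sum[of id ?\<Pi> "?G (L s)"]) (auto simp: permutes_id)
    also have "\<dots> = (s - s0)\<^sup>2 * poly Q s" by (simp add: Q)
    also have "\<dots> \<le> (s - s0)\<^sup>2 * B" using elim by (intro mult_left_mono) auto
    finally have "(L s i - ?a i)\<^sup>2 \<le> 2 * B / \<kappa> * (s - s0)\<^sup>2"
      using \<kappa> by (simp add: field_simps)
    from real_sqrt_le_mono[OF this] show ?case
      by (simp only: real_sqrt_mult[of "2 * B / \<kappa>"] real_sqrt_abs)
  qed
  then show ?thesis by (rule that)
qed

end

section \<open>Eigenvalues of a hyperbolic polynomial\<close>

lemma map_poly_of_real_mult:
  "map_poly complex_of_real (p * q) = map_poly of_real p * map_poly of_real q"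
  by (rule poly_eqI) (simp add: coeff_map_poly coeff_mult)

text \<open>Induction on the degree: the fundamental theorem of algebra gives a complex root, which
  is real by assumption, and the cofactor inherits real-rootedness.\<close>

lemma real_rooted_factorization:
  fixes q :: "real poly"
  assumes "q \<noteq> 0" and "\<And>z. poly (map_poly complex_of_real q) z = 0 \<Longrightarrow> z \<in> \<real>"
  shows "\<exists>M. size M = degree q \<and> q = smult (lead_coeff q) (\<Prod>a\<in>#M. [:- a, 1:])"
  using assms
proof (induction "degree q" arbitrary: q)
  case 0
  from 0(1)[symmetric] obtain c where "q = [:c:]" by (rule degree_eq_zeroE)
  then show ?case by (intro exI[of _ "{#}"]) simp
next
  case (Suc n)
  have "degree (map_poly complex_of_real q) = degree q" by (simp add: degree_map_poly)
  then have "\<not> constant (poly (map_poly complex_of_real q))"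
    using Suc.hyps(2) by (simp add: constant_degree)
  then obtain z where z: "poly (map_poly complex_of_real q) z = 0"
    using fundamental_theorem_of_algebra by blast
  then obtain a where a: "z = of_real a" using Suc.prems(2) by (auto elim: Reals_cases)
  have "poly (map_poly complex_of_real q) (of_real a) = of_real (poly q a)"
    by (induction q) (simp_all add: map_poly_pCons)
  then have "poly q a = 0" using z a by simp
  then obtain r where r: "q = [:- a, 1:] * r" by (auto simp: poly_eq_0_iff_dvd dvd_def)
  have r0: "r \<noteq> 0" using r Suc.prems(1) by auto
  have "degree q = Suc (degree r)" unfolding r using r0 by (subst degree_mult_eq) auto
  then have n: "n = degree r" using Suc.hyps(2) by simp
  have "z \<in> \<real>" if "poly (map_poly complex_of_real r) z = 0" for z
    using Suc.prems(2)[of z] that unfolding r map_poly_of_real_mult poly_mult by simp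
  from Suc.hyps(1)[OF n r0 this]
  obtain M where M: "size M = degree r" "r = smult (lead_coeff r) (\<Prod>a\<in>#M. [:- a, 1:])" by blast
  have lead: "lead_coeff q = lead_coeff r" unfolding r lead_coeff_mult by simp
  have "q = [:- a, 1:] * smult (lead_coeff r) (\<Prod>a\<in>#M. [:- a, 1:])"
    unfolding M(2)[symmetric] by (rule r)
  also have "\<dots> = smult (lead_coeff q) (\<Prod>a\<in>#add_mset a M. [:- a, 1:])"
    by (simp only: lead image_mset_add_mset prod_mset.add_mset mult_smult_right)
  finally have "q = smult (lead_coeff q) (\<Prod>a\<in>#add_mset a M. [:- a, 1:])" .
  moreover have "size (add_mset a M) = degree q" using M(1) n Suc.hyps(2) by simp
  ultimately show ?case by blast
qed

text \<open>Reads the degree and a coefficient off the asymptotics. Since \<open>q\<close> divided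
  by \<open>t ^ degree q\<close> tends to the leading coefficient, a degree above \<open>d\<close>
  would force that coefficient to be 0, and a degree below \<open>d\<close> forces
  \<open>l = 0\<close>.\<close>

lemma poly_growth:
  fixes q :: "real poly"
  assumes lim: "((\<lambda>t. poly q t / t ^ d) \<longlongrightarrow> l) at_top"
  shows "degree q \<le> d" and "coeff q d = l"
proof -
  have lead: "((\<lambda>t. poly q t / t ^ degree q) \<longlongrightarrow> lead_coeff q) at_top"
    using poly_divide_tendsto_aux[of q] at_top_le_at_infinity tendsto_mono by blast
  have vanish: "((\<lambda>t. f t / t ^ n / t ^ m) \<longlongrightarrow> 0) at_top"
    if "((\<lambda>t. f t / t ^ n) \<longlongrightarrow> (c :: real)) at_top" "0 < m" for f n c m
  proof -
    have "((\<lambda>t. f t / t ^ n * (inverse t) ^ m) \<longlongrightarrow> c * 0 ^ m) at_top"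
      using that by (intro tendsto_intros tendsto_inverse_0_at_top filterlim_ident)
    then show ?thesis using that(2) by (simp add: divide_inverse power_inverse power_0_left)
  qed
  show deg: "degree q \<le> d"
  proof (rule ccontr)
    assume "\<not> ?thesis"
    then have d: "degree q = d + (degree q - d)" "0 < degree q - d" by auto
    have "((\<lambda>t. poly q t / t ^ degree q) \<longlongrightarrow> 0) at_top"
      using vanish[OF lim d(2)] by (subst d(1)) (simp add: power_add)
    with lead have "lead_coeff q = 0" using tendsto_unique trivial_limit_at_top_linorder by blast
    then show False using d(2) by simp
  qed
  show "coeff q d = l"
  proof (cases "degree q = d")
    case True
    with lead lim show ?thesis using tendsto_unique trivial_limit_at_top_linorder by blast
  next
    case False
    then have d: "d = degree q + (d - degree q)" "0 < d - degree q" using deg by auto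
    have "((\<lambda>t. poly q t / t ^ d) \<longlongrightarrow> 0) at_top"
      using vanish[OF lead d(2)] by (subst d(1)) (simp add: power_add)
    with lim have "l = 0" using tendsto_unique trivial_limit_at_top_linorder by blast
    then show ?thesis using False deg by (simp add: coeff_eq_0)
  qed
qed

text \<open>An induction principle: \<open>\<F>\<close> is any algebra of functions containing the
  coordinates of \<open>g\<close>. It is used for polynomials in one and in two real
  parameters.\<close>

lemma homogeneous_polynomial_closure:
  fixes g :: "'a \<Rightarrow> real ^ 'n"
  assumes p: "homogeneous_polynomial d p"
    and const: "\<And>c. (\<lambda>_. c) \<in> \<F>"
    and add: "\<And>f g. f \<in> \<F> \<Longrightarrow> g \<in> \<F> \<Longrightarrow> (\<lambda>a. f a + g a) \<in> \<F>"
    and mult: "\<And>f g. f \<in> \<F> \<Longrightarrow> g \<in> \<F> \<Longrightarrow> (\<lambda>a. f a * g a) \<in> \<F>"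
    and coord: "\<And>j. (\<lambda>a. g a $ j) \<in> \<F>"
  shows "(\<lambda>a. p (g a)) \<in> \<F>"
proof -
  have sum: "(\<lambda>a. \<Sum>j\<in>J. f j a) \<in> \<F>" if "\<And>j. f j \<in> \<F>" for J and f :: "('n \<Rightarrow> nat) \<Rightarrow> 'a \<Rightarrow> real"
    using that by (induction J rule: infinite_finite_induct) (auto intro: const add)
  have prod: "(\<lambda>a. \<Prod>j\<in>J. f j a) \<in> \<F>" if "\<And>j. f j \<in> \<F>" for J and f :: "'n \<Rightarrow> 'a \<Rightarrow> real"
    using that by (induction J rule: infinite_finite_induct) (auto intro: const mult)
  have power: "(\<lambda>a. f a ^ n) \<in> \<F>" if "f \<in> \<F>" for f n
    using that by (induction n) (auto intro: const mult)
  obtain c where "\<And>x. p x = (\<Sum>\<alpha> | (\<Sum>j\<in>UNIV. \<alpha> j) = d. c \<alpha> * (\<Prod>j\<in>UNIV. x $ j ^ \<alpha> j))"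
    using p unfolding homogeneous_polynomial_def by blast
  then show ?thesis by (simp add: sum mult const prod power coord)
qed

lemma homogeneous_polynomial_scale:
  assumes "homogeneous_polynomial d p"
  shows "p (c *\<^sub>R x) = c ^ d * p x"
proof -
  obtain b where "\<And>x. p x = (\<Sum>\<alpha> | (\<Sum>j\<in>UNIV. \<alpha> j) = d. b \<alpha> * (\<Prod>j\<in>UNIV. x $ j ^ \<alpha> j))"
    using assms unfolding homogeneous_polynomial_def by blast
  then show ?thesis
    by (auto simp: sum_distrib_left power_mult_distrib prod.distrib power_sum intro!: sum.cong)
qed

locale hyperbolic =
  fixes d :: nat and p :: "real ^ 'n \<Rightarrow> real" and e :: "real ^ 'n"
  assumes hyperbolic: "hyperbolic_polynomial d p e"
begin

abbreviation "ev \<equiv> eigenvalues d p e"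

lemma homogeneous: "homogeneous_polynomial d p" and p_e [simp]: "p e \<noteq> 0"
  using hyperbolic unfolding hyperbolic_polynomial_def by auto

lemmas scale = homogeneous_polynomial_scale[OF homogeneous]

lemma p_affine_line: "\<exists>P. \<forall>t. p (x + t *\<^sub>R y) = poly P t"
proof -
  have "(\<lambda>t. p (x + t *\<^sub>R y)) \<in> {f. \<exists>P. f = poly P}"
  proof (rule homogeneous_polynomial_closure[OF homogeneous])
    show "(\<lambda>_. c) \<in> {f. \<exists>P. f = poly P}" for c :: real
      by (auto intro!: exI[of _ "[:c:]"])
    show "(\<lambda>t. f t + g t) \<in> {f. \<exists>P. f = poly P}" "(\<lambda>t. f t * g t) \<in> {f. \<exists>P. f = poly P}"
      if "f \<in> {f. \<exists>P. f = poly P}" "g \<in> {f. \<exists>P. f = poly P}" for f g :: "real \<Rightarrow> real"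
      using that by (auto simp flip: poly_add poly_mult)
    show "(\<lambda>t. (x + t *\<^sub>R y) $ j) \<in> {f. \<exists>P. f = poly P}" for j
      by (auto intro!: exI[of _ "[:x $ j, y $ j:]"])
  qed
  then show ?thesis by (auto simp: fun_eq_iff)
qed

lemma poly_line_poly: "poly (line_poly p e x) t = p (x - t *\<^sub>R e)"
proof -
  obtain P where P: "\<And>t. p (x + t *\<^sub>R (- e)) = poly P t" using p_affine_line by metis
  have "\<forall>t. poly (line_poly p e x) t = p (x - t *\<^sub>R e)"
    unfolding line_poly_def
  proof (rule theI[of _ P])
    show "\<forall>t. poly P t = p (x - t *\<^sub>R e)" using P by simp
    show "q = P" if "\<forall>t. poly q t = p (x - t *\<^sub>R e)" for q
      using that P by (simp add: poly_eq_poly_eq_iff[symmetric] fun_eq_iff)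
  qed
  then show ?thesis by blast
qed

text \<open>By homogeneity \<open>p (x - t e)\<close> is \<open>t ^ d\<close> times
  \<open>p (- e + x / t)\<close>, and the second factor tends to \<open>p (- e)\<close>.\<close>

lemma degree_line_poly: "degree (line_poly p e x) = d"
  and lead_coeff_line_poly: "coeff (line_poly p e x) d = (-1) ^ d * p e"
proof -
  obtain P where P: "\<And>t. p (- e + t *\<^sub>R x) = poly P t" using p_affine_line by metis
  have "((\<lambda>t. poly P (inverse t)) \<longlongrightarrow> poly P 0) at_top"
    by (intro isCont_tendsto_compose[OF poly_isCont] tendsto_inverse_0_at_top filterlim_ident)
  moreover have "poly P 0 = (-1) ^ d * p e"
    using P[of 0] scale[of "-1" e] by simp
  moreover have "\<forall>\<^sub>F t in at_top. poly P (inverse t) = poly (line_poly p e x) t / t ^ d"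
    using eventually_gt_at_top[of 0]
  proof eventually_elim
    case (elim t)
    have "p (x - t *\<^sub>R e) = p (t *\<^sub>R (- e + inverse t *\<^sub>R x))"
      using elim by (simp add: algebra_simps)
    then show ?case using elim by (simp add: P[symmetric] scale poly_line_poly)
  qed
  ultimately have lim: "((\<lambda>t. poly (line_poly p e x) t / t ^ d) \<longlongrightarrow> (-1) ^ d * p e) at_top"
    by (simp add: tendsto_cong)
  from poly_growth[OF this] show "coeff (line_poly p e x) d = (-1) ^ d * p e"
    and "degree (line_poly p e x) = d"
    by (auto intro!: antisym le_degree)
qed

text \<open>Together with \<open>eigenvalues_exist\<close> this replaces the sorted list of roots by
  a characterisation through a factorisation, from which scaling and negation of eigenvalues
  follow.\<close>

lemma eigenvalues_unique:
  assumes v: "antimono_on {1..d} v" "\<And>i. i \<notin> {1..d} \<Longrightarrow> v i = 0"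
    and prod: "\<And>t. p (x - t *\<^sub>R e) = p e * (\<Prod>i\<in>{1..d}. v i - t)"
  shows "ev x = v"
proof -
  \<comment> \<open>The indices run downwards because the sorted list of roots ascends while
    \<open>v\<close> decreases.\<close>
  let ?xs = "map v (rev [1..<Suc d])"
  have "poly (line_poly p e x) t = poly (smult (p e) (\<Prod>i\<in>{1..d}. [:v i, -1:])) t" for t
    by (simp add: poly_line_poly prod poly_prod)
  then have "line_poly p e x = smult (p e) (\<Prod>i\<in>{1..d}. [:v i, -1:])"
    by (simp add: poly_eq_poly_eq_iff[symmetric] fun_eq_iff)
  also have "\<dots> = smult (p e) (\<Prod>i\<in>{1..d}. smult (-1) [:- v i, 1:])"
    by (auto intro!: arg_cong2[of _ _ _ _ smult] prod.cong)
  finally have line: "line_poly p e x = smult (p e * (-1) ^ d) (\<Prod>i\<in>{1..d}. [:- v i, 1:])"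
    by (simp only: prod_smult prod_constant smult_smult card_atLeastAtMost) simp
  have "proots (line_poly p e x) = image_mset v (mset_set {1..d})"
    unfolding line by (subst proots_smult) (simp_all add: proots_prod sum_unfold_sum_mset)
  also have "\<dots> = mset ?xs"
    by (simp add: atLeastLessThanSuc_atLeastAtMost del: upt_Suc)
  finally have "sorted_list_of_multiset (proots (line_poly p e x)) = sort ?xs"
    by (simp only: sorted_list_of_multiset_mset)
  also have "\<dots> = ?xs"
  proof (rule sorted_sort_id)
    show "sorted ?xs"
      unfolding sorted_iff_nth_mono
    proof (intro allI impI)
      fix i j assume "i \<le> j" "j < length ?xs"
      then show "?xs ! i \<le> ?xs ! j"
        using monotone_onD[OF v(1), of "d - j" "d - i"] by (auto simp: rev_nth Suc_diff_Suc simp del: upt_Suc)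
    qed
  qed
  finally have "rev (sorted_list_of_multiset (proots (line_poly p e x))) = map v [1..<Suc d]"
    by (simp add: rev_map[symmetric] del: upt_Suc)
  then show ?thesis
    using v(2) by (auto simp: eigenvalues_def fun_eq_iff simp del: upt_Suc)
qed

lemma eigenvalues_exist:
  "\<exists>v. antimono_on {1..d} v \<and> (\<forall>i. i \<notin> {1..d} \<longrightarrow> v i = 0) \<and>
    (\<forall>t. p (x - t *\<^sub>R e) = p e * (\<Prod>i\<in>{1..d}. v i - t))"
proof -
  let ?q = "line_poly p e x"
  have "z \<in> \<real>" if "poly (map_poly complex_of_real ?q) z = 0" for z
    using hyperbolic that unfolding hyperbolic_polynomial_def by blast
  moreover have "?q \<noteq> 0" using lead_coeff_line_poly[of x] by auto
  ultimately obtain M where M: "size M = d" "?q = smult ((-1) ^ d * p e) (\<Prod>a\<in>#M. [:- a, 1:])"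
    using real_rooted_factorization[of ?q] by (metis degree_line_poly lead_coeff_line_poly)
  let ?xs = "rev (sorted_list_of_multiset M)"
  define v where "v i = (if i \<in> {1..d} then ?xs ! (i - 1) else 0)" for i
  have len: "length ?xs = d" using M(1) by (metis length_rev mset_sorted_list_of_multiset size_mset)
  have anti: "antimono_on {1..d} v"
  proof (rule monotone_onI)
    fix i j assume ij: "i \<in> {1..d}" "j \<in> {1..d}" "i \<le> j"
    have "sorted (rev ?xs)" by simp
    then have "?xs ! (j - 1) \<le> ?xs ! (i - 1)"
      using ij len by (intro sorted_rev_nth_mono) auto
    then show "v j \<le> v i" using ij by (simp add: v_def)
  qed
  have "p (x - t *\<^sub>R e) = p e * (\<Prod>i\<in>{1..d}. v i - t)" for t
  proof -
    have "(\<Prod>a\<in>#M. poly [:- a, 1:] t) = (\<Prod>a\<in>#mset ?xs. t - a)" by simp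
    also have "\<dots> = (\<Prod>a\<leftarrow>?xs. t - a)"
      by (simp only: mset_map[symmetric] prod_mset_prod_list)
    also have "\<dots> = (\<Prod>i<d. t - ?xs ! i)"
      using len by (simp add: prod.list_conv_set_nth atLeast0LessThan)
    also have "\<dots> = (\<Prod>i\<in>{1..d}. t - v i)"
      by (rule prod.reindex_bij_witness[of _ "\<lambda>i. i - 1" Suc]) (auto simp: v_def)
    also have "\<dots> = (-1) ^ d * (\<Prod>i\<in>{1..d}. v i - t)"
      by (subst prod_diff_swap) simp
    finally have prod: "(\<Prod>a\<in>#M. poly [:- a, 1:] t) = (-1) ^ d * (\<Prod>i\<in>{1..d}. v i - t)" .
    have "p (x - t *\<^sub>R e) = (-1) ^ d * p e * (\<Prod>a\<in>#M. poly [:- a, 1:] t)"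
      by (subst poly_line_poly[symmetric], subst M(2))
         (simp add: poly_prod_mset image_mset.compositionality o_def)
    also have "\<dots> = ((-1) ^ d * (-1) ^ d) * (p e * (\<Prod>i\<in>{1..d}. v i - t))"
      unfolding prod by (simp only: mult_ac)
    also have "(-1 :: real) ^ d * (-1) ^ d = 1"
      by (simp flip: power_mult_distrib)
    finally show ?thesis by simp
  qed
  with anti show ?thesis by (intro exI[of _ v]) (auto simp: v_def)
qed

lemma antimono_eigenvalues: "antimono_on {1..d} (ev x)"
  and eigenvalues_outside: "i \<notin> {1..d} \<Longrightarrow> ev x i = 0"
  and p_eq_prod: "p (x - t *\<^sub>R e) = p e * (\<Prod>i\<in>{1..d}. ev x i - t)"
  using eigenvalues_exist[of x] eigenvalues_unique[of _ x] by metis+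

lemma eigenvalues_scale:
  assumes "0 < c"
  shows "ev (c *\<^sub>R x) = (\<lambda>i. c * ev x i)"
proof (rule eigenvalues_unique)
  show "antimono_on {1..d} (\<lambda>i. c * ev x i)"
    using antimono_eigenvalues[of x] assms by (auto simp: monotone_on_def)
  show "p (c *\<^sub>R x - t *\<^sub>R e) = p e * (\<Prod>i\<in>{1..d}. c * ev x i - t)" for t
  proof -
    have "p (c *\<^sub>R x - t *\<^sub>R e) = p (c *\<^sub>R (x - (t / c) *\<^sub>R e))"
      using assms by (simp add: algebra_simps)
    also have "\<dots> = p e * (\<Prod>i\<in>{1..d}. c * (ev x i - t / c))"
      by (simp add: scale p_eq_prod prod.distrib del: One_nat_def)
    also have "\<dots> = p e * (\<Prod>i\<in>{1..d}. c * ev x i - t)"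
      using assms by (simp add: right_diff_distrib)
    finally show ?thesis .
  qed
qed (simp add: eigenvalues_outside)

lemma eigenvalues_minus: "ev (- x) = (\<lambda>i. - ev x (Suc d - i))"
proof (rule eigenvalues_unique)
  show "antimono_on {1..d} (\<lambda>i. - ev x (Suc d - i))"
    by (rule monotone_onI) (auto intro!: monotone_onD[OF antimono_eigenvalues])
  \<comment> \<open>Truncated subtraction sends \<open>0\<close> to \<open>Suc d\<close> and every
    \<open>i > d\<close> to \<open>0\<close>, both outside \<open>{1..d}\<close>.\<close>
  show "- ev x (Suc d - i) = 0" if "i \<notin> {1..d}" for i
    using that by (subst eigenvalues_outside) auto
  show "p (- x - t *\<^sub>R e) = p e * (\<Prod>i\<in>{1..d}. - ev x (Suc d - i) - t)" for t
  proof -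
    have "p (- x - t *\<^sub>R e) = p ((-1) *\<^sub>R (x - (- t) *\<^sub>R e))" by simp
    also have "\<dots> = p e * (\<Prod>i\<in>{1..d}. (-1) * (ev x i - (- t)))"
      by (simp only: scale p_eq_prod prod.distrib) simp
    also have "(\<Prod>i\<in>{1..d}. (-1) * (ev x i - (- t))) = (\<Prod>i\<in>{1..d}. - ev x (Suc d - i) - t)"
      by (rule prod.reindex_bij_witness[of _ "\<lambda>i. Suc d - i" "\<lambda>i. Suc d - i"]) auto
    finally show ?thesis .
  qed
qed

lemma prod_one_minus_eigenvalues: "(\<Prod>i\<in>{1..d}. 1 - u * ev z i) = p (e - u *\<^sub>R z) / p e"
proof (cases "u = 0")
  case False
  have "p (e - u *\<^sub>R z) = p ((- u) *\<^sub>R (z - (1 / u) *\<^sub>R e))"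
    using False by (simp add: algebra_simps)
  also have "\<dots> = p e * (\<Prod>i\<in>{1..d}. (- u) * (ev z i - 1 / u))"
    by (simp only: scale p_eq_prod prod.distrib) simp
  also have "\<dots> = p e * (\<Prod>i\<in>{1..d}. 1 - u * ev z i)"
    using False by (simp add: algebra_simps)
  finally show ?thesis by simp
qed simp

text \<open>By \<open>prod_one_minus_eigenvalues\<close> the required product is
  \<open>p (e - u (x + s y)) / p e\<close>, which is polynomial in \<open>u\<close> and
  \<open>s\<close> because \<open>p\<close> is a polynomial.\<close>

lemma pencil: "\<exists>R. pencil d (\<lambda>s. ev (x + s *\<^sub>R y)) R"
proof -
  let ?F = "{f. \<exists>P. \<forall>u s. f (u, s) = poly (poly P [:u:]) (s :: real)} :: (real \<times> real \<Rightarrow> real) set"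
  have "(\<lambda>(u, s). p (e - u *\<^sub>R (x + s *\<^sub>R y))) \<in> ?F"
    unfolding case_prod_unfold
  proof (rule homogeneous_polynomial_closure[OF homogeneous])
    show "(\<lambda>_. c) \<in> ?F" for c
      by (auto intro!: exI[of _ "[:[:c:]:]"])
    show "(\<lambda>a. f a + g a) \<in> ?F" if "f \<in> ?F" "g \<in> ?F" for f g
      using that by (auto simp flip: poly_add)
    show "(\<lambda>a. f a * g a) \<in> ?F" if "f \<in> ?F" "g \<in> ?F" for f g
      using that by (auto simp flip: poly_mult)
    show "(\<lambda>a. (e - fst a *\<^sub>R (x + snd a *\<^sub>R y)) $ j) \<in> ?F" for j
      by (auto simp: algebra_simps intro!: exI[of _ "[:[:e $ j:], [:- (x $ j), - (y $ j):]:]"])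
  qed
  then obtain P where P: "\<And>u s. p (e - u *\<^sub>R (x + s *\<^sub>R y)) = poly (poly P [:u:]) s" by auto
  have "pencil d (\<lambda>s. ev (x + s *\<^sub>R y)) (smult [:1 / p e:] P)"
    by unfold_locales (simp_all add: antimono_eigenvalues prod_one_minus_eigenvalues P del: One_nat_def)
  then show ?thesis ..
qed

end

section \<open>Sums of the largest eigenvalues\<close>

text \<open>If the order were below \<open>m\<close>, dividing the bound by the exact power of
  \<open>s - c\<close> would make the cofactor tend to 0 at \<open>c\<close>, although it is not
  divisible by \<open>s - c\<close>.\<close>

lemma order_ge_of_bound:
  fixes q :: "real poly"
  assumes "q \<noteq> 0" and bound: "\<forall>\<^sub>F s in at c. \<bar>poly q s\<bar> \<le> K * \<bar>s - c\<bar> ^ m"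
  shows "m \<le> order c q"
proof (rule ccontr)
  define n where "n = order c q"
  assume "\<not> ?thesis"
  then have n: "m = n + (m - n)" "0 < m - n" by (auto simp: n_def)
  obtain r where r: "q = [:- c, 1:] ^ n * r" "\<not> [:- c, 1:] dvd r"
    using order_decomp[OF \<open>q \<noteq> 0\<close>, of c] unfolding n_def by blast
  have "((\<lambda>s. K * \<bar>s - c\<bar> ^ (m - n)) \<longlongrightarrow> K * \<bar>c - c\<bar> ^ (m - n)) (at c)"
    by (intro tendsto_intros)
  moreover have "K * \<bar>c - c\<bar> ^ (m - n) = 0" using n(2) by simp
  ultimately have zero: "((\<lambda>s. K * \<bar>s - c\<bar> ^ (m - n)) \<longlongrightarrow> 0) (at c)" by (simp only:)
  have "\<forall>\<^sub>F s in at c. norm (poly r s) \<le> K * \<bar>s - c\<bar> ^ (m - n)"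
    using bound eventually_neq_at_within[of c c UNIV]
  proof eventually_elim
    case (elim s)
    have "\<bar>poly q s\<bar> = \<bar>s - c\<bar> ^ n * \<bar>poly r s\<bar>"
      by (simp add: r(1) abs_mult power_abs)
    moreover have "K * \<bar>s - c\<bar> ^ m = \<bar>s - c\<bar> ^ n * (K * \<bar>s - c\<bar> ^ (m - n))"
      by (subst n(1)) (simp add: power_add)
    ultimately have "\<bar>s - c\<bar> ^ n * \<bar>poly r s\<bar> \<le> \<bar>s - c\<bar> ^ n * (K * \<bar>s - c\<bar> ^ (m - n))"
      using elim(1) by (simp only:)
    moreover have "0 < \<bar>s - c\<bar> ^ n" using elim(2) by simp
    ultimately show ?case by (simp only: mult_le_cancel_left_pos real_norm_def)
  qed
  then have "(poly r \<longlongrightarrow> 0) (at c)" by (rule Lim_null_comparison) (rule zero)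
  moreover have "(poly r \<longlongrightarrow> poly r c) (at c)" using poly_isCont isCont_def by blast
  ultimately have "poly r c = 0" using tendsto_unique trivial_limit_at by blast
  then show False using r(2) by (simp add: poly_eq_0_iff_dvd)
qed

lemma sum_order_le_degree:
  fixes q :: "real poly"
  assumes "q \<noteq> 0" "finite A"
  shows "(\<Sum>a\<in>A. order a q) \<le> degree q"
proof -
  have "(\<Sum>a\<in>A. order a q) = (\<Sum>a\<in>A. count (proots q) a)"
    using assms(1) by simp
  also have "\<dots> = (\<Sum>a\<in>A \<inter> set_mset (proots q). count (proots q) a)"
    using assms(2) by (intro sum.mono_neutral_right) (auto simp: not_in_iff simp del: count_proots)
  also have "\<dots> \<le> (\<Sum>a\<in>set_mset (proots q). count (proots q) a)"
    by (intro sum_mono2) auto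
  also have "\<dots> = size (proots q)" by (simp only: size_multiset_overloaded_eq)
  also have "\<dots> \<le> degree q" by (rule size_proots_le)
  finally show ?thesis .
qed

text \<open>The parts of \<open>S\<close> and \<open>{1..k}\<close> outside their intersection have
  equally many elements, and \<open>v k\<close> separates the values of \<open>v\<close> on
  them.\<close>

lemma antimono_sum_le_initial_sum:
  fixes v :: "nat \<Rightarrow> real"
  assumes v: "antimono_on {1..d} v" and S: "S \<subseteq> {1..d}" "card S = k"
  shows "(\<Sum>i\<in>S. v i) \<le> (\<Sum>i\<in>{1..k}. v i)"
proof (cases "k = 0")
  case True
  then show ?thesis using S finite_subset[OF S(1)] by simp
next
  case False
  let ?T = "{1..k}"
  have fin: "finite S" using S(1) finite_subset by blast
  have "k \<le> d" using card_mono[OF _ S(1)] S(2) by simp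
  have card: "card (S - ?T) = card (?T - S)"
    using card_Diff_subset_Int[of S ?T] card_Diff_subset_Int[of ?T S] fin S(2)
    by (simp add: Int_commute)
  have "(\<Sum>i\<in>S - ?T. v i) \<le> real (card (S - ?T)) * v k"
    using False S(1) \<open>k \<le> d\<close> by (intro sum_bounded_above monotone_onD[OF v]) auto
  also have "\<dots> \<le> (\<Sum>i\<in>?T - S. v i)"
    unfolding card using False \<open>k \<le> d\<close> by (intro sum_bounded_below monotone_onD[OF v]) auto
  finally have "(\<Sum>i\<in>S - ?T. v i) + (\<Sum>i\<in>S \<inter> ?T. v i) \<le> (\<Sum>i\<in>?T - S. v i) + (\<Sum>i\<in>?T \<inter> S. v i)"
    by (simp add: Int_commute)
  moreover have "(\<Sum>i\<in>S. v i) = (\<Sum>i\<in>S - ?T. v i) + (\<Sum>i\<in>S \<inter> ?T. v i)"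
    using sum.Int_Diff[OF fin, of v ?T] by simp
  moreover have "(\<Sum>i\<in>?T. v i) = (\<Sum>i\<in>?T - S. v i) + (\<Sum>i\<in>?T \<inter> S. v i)"
    using sum.Int_Diff[of ?T v S] by simp
  ultimately show ?thesis by simp
qed

context hyperbolic
begin

lemma continuous_eigenvalue: "continuous_on UNIV (\<lambda>s. ev (x + s *\<^sub>R y) i)"
proof (cases "i \<in> {1..d}")
  case True
  obtain R where "pencil d (\<lambda>s. ev (x + s *\<^sub>R y)) R" using pencil by blast
  then show ?thesis using True by (rule pencil.continuous_L)
qed (simp add: eigenvalues_outside)

text \<open>For \<open>s > 0\<close> the quotient is an eigenvalue of \<open>y + x / s\<close>, so
  this is continuity at 0 along the line through \<open>y\<close> in direction
  \<open>x\<close>.\<close>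

lemma tendsto_eigenvalue_at_top:
  "((\<lambda>s. ev (x + s *\<^sub>R y) i / s) \<longlongrightarrow> ev y i) at_top"
proof -
  have "isCont (\<lambda>u. ev (y + u *\<^sub>R x) i) 0"
    using continuous_eigenvalue[of y x i] by (simp add: continuous_on_eq_continuous_at)
  then have "((\<lambda>s. ev (y + inverse s *\<^sub>R x) i) \<longlongrightarrow> ev (y + 0 *\<^sub>R x) i) at_top"
    by (rule isCont_tendsto_compose) (intro tendsto_inverse_0_at_top filterlim_ident)
  moreover have "\<forall>\<^sub>F s in at_top. ev (y + inverse s *\<^sub>R x) i = ev (x + s *\<^sub>R y) i / s"
    using eventually_gt_at_top[of 0]
  proof eventually_elim
    case (elim s)
    then have "x + s *\<^sub>R y = s *\<^sub>R (y + inverse s *\<^sub>R x)" by (simp add: algebra_simps)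
    then show ?case using elim eigenvalues_scale[of s "y + inverse s *\<^sub>R x"] by simp
  qed
  ultimately show ?thesis by (simp add: tendsto_cong)
qed

text \<open>
  Let \<open>\<sigma>\<close> denote the sum of the \<open>k\<close> largest eigenvalues, and suppose \<open>\<sigma> (x + y) > \<sigma> x + \<sigma> y\<close>.
  A line \<open>\<alpha> + \<beta> s\<close> with \<open>\<alpha> > \<sigma> x\<close>, \<open>\<beta> > \<sigma> y\<close> and \<open>\<alpha> + \<beta> < \<sigma> (x + y)\<close> lies above all
  \<open>D = d choose k\<close> sums of \<open>k\<close> eigenvalues of \<open>x + s y\<close> at \<open>s = 0\<close> and below all of them for
  \<open>s \<rightarrow> - \<infinity>\<close>, so each sum crosses it at some \<open>s < 0\<close>; the largest one crosses it again between
  \<open>0\<close> and \<open>1\<close>. This is one zero too many for the product of the \<open>D\<close> differences, which is a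
  polynomial of degree at most \<open>D\<close>. Zeros are counted with multiplicity because the
  eigenvalues are locally Lipschitz.
\<close>

theorem sum_largest_eigenvalues_subadditive:
  assumes k: "k \<le> d"
  shows "(\<Sum>i\<in>{1..k}. ev (x + y) i) \<le> (\<Sum>i\<in>{1..k}. ev x i) + (\<Sum>i\<in>{1..k}. ev y i)"
proof (rule ccontr)
  let ?\<sigma> = "\<lambda>z. \<Sum>i\<in>{1..k}. ev z i"
  \<comment> \<open>A third of the excess: one share goes to \<open>\<alpha>\<close>, one to
    \<open>\<beta>\<close>, and the last keeps \<open>\<alpha> + \<beta>\<close> below the sum at
    \<open>x + y\<close>.\<close>
  define \<epsilon> where "\<epsilon> = (?\<sigma> (x + y) - ?\<sigma> x - ?\<sigma> y) / 3"
  assume "\<not> ?thesis"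
  then have \<epsilon>: "0 < \<epsilon>" by (simp add: \<epsilon>_def)
  define \<alpha> \<beta> where "\<alpha> = ?\<sigma> x + \<epsilon>" and "\<beta> = ?\<sigma> y + \<epsilon>"
  define \<S> where "\<S> = {S. S \<subseteq> {1..d} \<and> card S = k}"
  define \<tau> where "\<tau> S s = \<alpha> + \<beta> * s - (\<Sum>i\<in>S. ev (x + s *\<^sub>R y) i)" for S s
  have fin: "finite \<S>" unfolding \<S>_def by simp
  have le_\<sigma>: "(\<Sum>i\<in>S. ev z i) \<le> ?\<sigma> z" if "S \<in> \<S>" for S z
    using antimono_sum_le_initial_sum[OF antimono_eigenvalues] that by (auto simp: \<S>_def)
  have cont: "continuous_on A (\<tau> S)" for A S
    unfolding \<tau>_def
    by (intro continuous_intros continuous_on_subset[OF continuous_eigenvalue]) auto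
  obtain R where "pencil d (\<lambda>s. ev (x + s *\<^sub>R y)) R" using pencil by blast
  then interpret pencil d "\<lambda>s. ev (x + s *\<^sub>R y)" R .

  let ?F = "\<lambda>v s. \<Prod>S\<in>\<S>. poly [:\<alpha>, \<beta>:] s - (\<Sum>i\<in>S. v i)"
  have "poly_fun d ?F"
    by (intro poly_fun_intros) (auto simp: \<S>_def)
  moreover have "symmetric_in d ?F"
    unfolding symmetric_in_def
  proof (intro allI impI ext)
    fix f v s assume f: "f permutes {1..d}"
    have inj: "inj_on g S" if "g permutes {1..d}" for g S
      using permutes_inj[OF that] inj_on_subset by blast
    have maps: "g ` S \<in> \<S>" if "g permutes {1..d}" "S \<in> \<S>" for g S
      using that permutes_image[OF that(1)] card_image[OF inj[OF that(1)]]
      by (auto simp: \<S>_def simp del: atLeastAtMost_iff)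
    have "bij_betw (image f) \<S> \<S>"
      using f by (intro bij_betw_byWitness[where f' = "image (inv f)"])
        (auto simp: maps permutes_inv image_image permutes_inverses)
    then have "?F v s = (\<Prod>S\<in>\<S>. poly [:\<alpha>, \<beta>:] s - (\<Sum>i\<in>f ` S. v i))"
      by (rule prod.reindex_bij_betw[symmetric])
    then show "?F (v \<circ> f) s = ?F v s"
      by (simp add: sum.reindex[OF inj[OF f]])
  qed
  ultimately obtain q where q_F: "\<And>s. ?F (ev (x + s *\<^sub>R y)) s = poly q s"
    using symmetric_poly_fun_poly[of ?F] by blast
  then have q: "poly q s = (\<Prod>S\<in>\<S>. \<tau> S s)" for s
    unfolding q_F[symmetric] \<tau>_def by (simp add: mult.commute)

  \<comment> \<open>Dividing each of the \<open>card \<S>\<close> factors of \<open>q\<close> by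
    \<open>s\<close> leaves a finite limit, which bounds the degree of \<open>q\<close>.\<close>
  have "((\<lambda>s. \<Prod>S\<in>\<S>. \<alpha> * inverse s + \<beta> - (\<Sum>i\<in>S. ev (x + s *\<^sub>R y) i / s))
      \<longlongrightarrow> (\<Prod>S\<in>\<S>. \<alpha> * 0 + \<beta> - (\<Sum>i\<in>S. ev y i))) at_top"
    by (intro tendsto_intros tendsto_eigenvalue_at_top tendsto_inverse_0_at_top filterlim_ident)
  moreover have "\<forall>\<^sub>F s in at_top. (\<Prod>S\<in>\<S>. \<alpha> * inverse s + \<beta> - (\<Sum>i\<in>S. ev (x + s *\<^sub>R y) i / s))
      = poly q s / s ^ card \<S>"
    using eventually_gt_at_top[of 0]
  proof eventually_elim
    case (elim s)
    then have "\<alpha> * inverse s + \<beta> - (\<Sum>i\<in>S. ev (x + s *\<^sub>R y) i / s) = \<tau> S s / s" for S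
      by (simp add: \<tau>_def sum_divide_distrib[symmetric] field_simps)
    then show ?case by (simp add: q prod_dividef)
  qed
  ultimately have "((\<lambda>s. poly q s / s ^ card \<S>) \<longlongrightarrow> (\<Prod>S\<in>\<S>. \<alpha> * 0 + \<beta> - (\<Sum>i\<in>S. ev y i))) at_top"
    by (rule Lim_transform_eventually)
  then have deg: "degree q \<le> card \<S>" by (rule poly_growth)

  have pos: "0 < \<tau> S 0" if "S \<in> \<S>" for S
    using le_\<sigma>[OF that, of x] \<epsilon> by (simp add: \<tau>_def \<alpha>_def)
  then have "0 < poly q 0" unfolding q by (rule prod_pos)
  then have q0: "q \<noteq> 0" by auto

  have "\<exists>s<0. \<tau> S s = 0" if S: "S \<in> \<S>" for S
  proof -
    \<comment> \<open>With \<open>s = - r\<close> the behaviour at minus infinity becomes a limit at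
      plus infinity in direction \<open>- y\<close>.\<close>
    have "((\<lambda>r. \<alpha> * inverse r - \<beta> - (\<Sum>i\<in>S. ev (x + r *\<^sub>R (- y)) i / r))
        \<longlongrightarrow> \<alpha> * 0 - \<beta> - (\<Sum>i\<in>S. ev (- y) i)) at_top"
      by (intro tendsto_intros tendsto_eigenvalue_at_top tendsto_inverse_0_at_top filterlim_ident)
    moreover have "\<alpha> * 0 - \<beta> - (\<Sum>i\<in>S. ev (- y) i) < 0"
    proof -
      \<comment> \<open>Negation reverses the order of eigenvalues, so the sum over \<open>S\<close>
        for \<open>- y\<close> is minus the sum over the reflected set for \<open>y\<close>, again
        one of the sums in \<open>\<S>\<close>.\<close>
      let ?r = "\<lambda>i. Suc d - i"
      have sub: "S \<subseteq> {1..d}" using S by (simp add: \<S>_def)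
      have inj: "inj_on ?r S"
      proof (rule inj_onI)
        fix i j assume "i \<in> S" "j \<in> S" "?r i = ?r j"
        moreover from this have "i \<le> d" "j \<le> d" using sub by auto
        ultimately show "i = j" by linarith
      qed
      have "?r ` S \<subseteq> {1..d}" using sub by (fastforce simp: subset_iff)
      then have "?r ` S \<in> \<S>" using S by (simp add: \<S>_def card_image[OF inj])
      then have "(\<Sum>i\<in>?r ` S. ev y i) \<le> ?\<sigma> y" by (rule le_\<sigma>)
      then show ?thesis
        using \<epsilon> by (simp add: eigenvalues_minus sum_negf sum.reindex[OF inj] \<beta>_def)
    qed
    ultimately have "\<forall>\<^sub>F r in at_top. \<alpha> * inverse r - \<beta> - (\<Sum>i\<in>S. ev (x + r *\<^sub>R (- y)) i / r) < 0"
      by (rule order_tendstoD(2))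
    with eventually_gt_at_top[of 0]
    obtain r where r: "0 < r" "\<alpha> * inverse r - \<beta> - (\<Sum>i\<in>S. ev (x + r *\<^sub>R (- y)) i / r) < 0"
      using eventually_happens'[OF _ eventually_conj] trivial_limit_at_top_linorder by blast
    have "\<tau> S (- r) = r * (\<alpha> * inverse r - \<beta> - (\<Sum>i\<in>S. ev (x + r *\<^sub>R (- y)) i / r))"
      using r(1) by (simp add: \<tau>_def sum_divide_distrib[symmetric] field_simps)
    also have "\<dots> < 0" using r by (simp add: mult_pos_neg)
    finally have neg: "\<tau> S (- r) < 0" .
    then obtain s where "- r \<le> s" "s \<le> 0" "\<tau> S s = 0"
      using IVT'[of "\<tau> S" "- r" 0 0] pos[OF S] r(1) cont by auto
    moreover have "s \<noteq> 0" using \<open>\<tau> S s = 0\<close> pos[OF S] by auto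
    ultimately show ?thesis by (intro exI[of _ s]) auto
  qed
  then obtain z where z: "\<And>S. S \<in> \<S> \<Longrightarrow> z S < 0 \<and> \<tau> S (z S) = 0" by metis

  have T: "{1..k} \<in> \<S>" using k by (auto simp: \<S>_def)
  have "3 * \<epsilon> = ?\<sigma> (x + y) - ?\<sigma> x - ?\<sigma> y" by (simp add: \<epsilon>_def)
  moreover have "\<tau> {1..k} 1 = ?\<sigma> x + ?\<sigma> y + 2 * \<epsilon> - ?\<sigma> (x + y)"
    unfolding \<tau>_def \<alpha>_def \<beta>_def by (simp del: One_nat_def)
  ultimately have "\<tau> {1..k} 1 < 0" using \<epsilon> by linarith
  then obtain z0 where "0 \<le> z0" "\<tau> {1..k} z0 = 0"
    using IVT2'[of "\<tau> {1..k}" 1 0 0] pos[OF T] cont by auto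
  then have z0: "0 < z0" "\<tau> {1..k} z0 = 0"
    using pos[OF T] by (auto simp: order_less_le)

  have mult: "card {S \<in> \<S>. \<tau> S c = 0} \<le> order c q" for c
  proof -
    \<comment> \<open>Only the factors vanishing at \<open>c\<close> contribute
      \<open>\<bar>s - c\<bar>\<close>; the others are merely bounded. The product then carries the
      number of vanishing factors as exponent.\<close>
    define \<delta> where "\<delta> S s = (if \<tau> S c = 0 then \<bar>s - c\<bar> else 1)" for S s
    have "\<exists>K. \<forall>\<^sub>F s in at c. \<bar>\<tau> S s\<bar> \<le> K * \<delta> S s"
      if S: "S \<in> \<S>" for S
    proof (cases "\<tau> S c = 0")
      case True
      have "\<forall>i\<in>S. \<exists>C. \<forall>\<^sub>F s in at c. \<bar>ev (x + s *\<^sub>R y) i - ev (x + c *\<^sub>R y) i\<bar> \<le> C * \<bar>s - c\<bar>"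
      proof
        fix i assume "i \<in> S"
        then have "i \<in> {1..d}" using S by (auto simp: \<S>_def)
        then show "\<exists>C. \<forall>\<^sub>F s in at c. \<bar>ev (x + s *\<^sub>R y) i - ev (x + c *\<^sub>R y) i\<bar> \<le> C * \<bar>s - c\<bar>"
          by (rule locally_Lipschitz_L) blast
      qed
      from bchoice[OF this] obtain C where C: "\<forall>i\<in>S. \<forall>\<^sub>F s in at c.
          \<bar>ev (x + s *\<^sub>R y) i - ev (x + c *\<^sub>R y) i\<bar> \<le> C i * \<bar>s - c\<bar>" ..
      have "finite S" using S finite_subset by (auto simp: \<S>_def)
      then have "\<forall>\<^sub>F s in at c. \<forall>i\<in>S. \<bar>ev (x + s *\<^sub>R y) i - ev (x + c *\<^sub>R y) i\<bar> \<le> C i * \<bar>s - c\<bar>"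
        using C by (simp add: eventually_ball_finite_distrib)
      then have "\<forall>\<^sub>F s in at c. \<bar>\<tau> S s\<bar> \<le> (\<bar>\<beta>\<bar> + (\<Sum>i\<in>S. C i)) * \<bar>s - c\<bar>"
      proof eventually_elim
        case (elim s)
        have "\<tau> S s = \<beta> * (s - c) - (\<Sum>i\<in>S. ev (x + s *\<^sub>R y) i - ev (x + c *\<^sub>R y) i)"
          using True by (simp add: \<tau>_def sum_subtractf algebra_simps)
        also have "\<bar>\<dots>\<bar> \<le> \<bar>\<beta> * (s - c)\<bar> + \<bar>\<Sum>i\<in>S. ev (x + s *\<^sub>R y) i - ev (x + c *\<^sub>R y) i\<bar>"
          by (rule abs_triangle_ineq4)
        also have "\<bar>\<Sum>i\<in>S. ev (x + s *\<^sub>R y) i - ev (x + c *\<^sub>R y) i\<bar>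
            \<le> (\<Sum>i\<in>S. \<bar>ev (x + s *\<^sub>R y) i - ev (x + c *\<^sub>R y) i\<bar>)"
          by (rule sum_abs)
        also have "\<dots> \<le> (\<Sum>i\<in>S. C i * \<bar>s - c\<bar>)"
          using elim by (intro sum_mono) auto
        finally show ?case by (simp add: abs_mult distrib_right sum_distrib_right)
      qed
      then show ?thesis using True by (auto simp: \<delta>_def)
    next
      case False
      have "((\<lambda>s. \<bar>\<tau> S s\<bar>) \<longlongrightarrow> \<bar>\<tau> S c\<bar>) (at c)"
        using cont[of UNIV S] by (intro tendsto_rabs) (simp add: continuous_on_def)
      then have "\<forall>\<^sub>F s in at c. \<bar>\<tau> S s\<bar> < \<bar>\<tau> S c\<bar> + 1" by (rule order_tendstoD) simp
      then have "\<forall>\<^sub>F s in at c. \<bar>\<tau> S s\<bar> \<le> \<bar>\<tau> S c\<bar> + 1" by eventually_elim simp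
      then show ?thesis using False by (intro exI[of _ "\<bar>\<tau> S c\<bar> + 1"]) (simp add: \<delta>_def)
    qed
    then have "\<forall>S\<in>\<S>. \<exists>K. \<forall>\<^sub>F s in at c. \<bar>\<tau> S s\<bar> \<le> K * \<delta> S s" by blast
    from bchoice[OF this] obtain K where
      "\<forall>S\<in>\<S>. \<forall>\<^sub>F s in at c. \<bar>\<tau> S s\<bar> \<le> K S * \<delta> S s" ..
    then have "\<forall>\<^sub>F s in at c. \<forall>S\<in>\<S>. \<bar>\<tau> S s\<bar> \<le> K S * \<delta> S s"
      using fin by (simp add: eventually_ball_finite_distrib)
    then have "\<forall>\<^sub>F s in at c. \<bar>poly q s\<bar> \<le> (\<Prod>S\<in>\<S>. K S) * \<bar>s - c\<bar> ^ card {S \<in> \<S>. \<tau> S c = 0}"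
    proof eventually_elim
      case (elim s)
      have "\<bar>poly q s\<bar> = (\<Prod>S\<in>\<S>. \<bar>\<tau> S s\<bar>)" by (simp add: q abs_prod)
      also have "\<dots> \<le> (\<Prod>S\<in>\<S>. K S * \<delta> S s)"
        using elim by (intro prod_mono) auto
      also have "\<dots> = (\<Prod>S\<in>\<S>. K S) * \<bar>s - c\<bar> ^ card {S \<in> \<S>. \<tau> S c = 0}"
        by (simp only: prod.distrib \<delta>_def prod.inter_filter[OF fin, symmetric] prod_constant)
      finally show ?case .
    qed
    then show ?thesis by (rule order_ge_of_bound[OF q0])
  qed

  have notin: "z0 \<notin> z ` \<S>" using z z0(1) by fastforce
  \<comment> \<open>Different sums may cross the line at the same point, so the sets
    \<open>S\<close> are grouped by the value of \<open>z S\<close>.\<close>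
  have "card \<S> = (\<Sum>c\<in>z ` \<S>. card {S \<in> \<S>. z S = c})"
    using sum.image_gen[OF fin, of "\<lambda>_. 1 :: nat" z] by (simp only: card_eq_sum)
  also have "\<dots> \<le> (\<Sum>c\<in>z ` \<S>. order c q)"
  proof (rule sum_mono)
    fix c
    have "card {S \<in> \<S>. z S = c} \<le> card {S \<in> \<S>. \<tau> S c = 0}"
      using z fin by (intro card_mono) auto
    then show "card {S \<in> \<S>. z S = c} \<le> order c q" using mult[of c] by linarith
  qed
  finally have "card \<S> \<le> (\<Sum>c\<in>z ` \<S>. order c q)" .
  moreover have "1 \<le> order z0 q"
  proof -
    have "card {{1..k}} \<le> card {S \<in> \<S>. \<tau> S z0 = 0}"
      using T z0 fin by (intro card_mono) auto
    then show ?thesis using mult[of z0] by simp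
  qed
  ultimately have "card \<S> + 1 \<le> (\<Sum>c\<in>insert z0 (z ` \<S>). order c q)"
    using notin fin by simp
  then show False
    using sum_order_le_degree[OF q0, of "insert z0 (z ` \<S>)"] fin deg by simp
qed

end

section \<open>The distance to the hyperbolicity cone\<close>

text \<open>Summation by parts, in the form of an induction: as \<open>c\<close> decreases and the
  partial sums are nonnegative, the weighted sum up to \<open>k\<close> is at least
  \<open>c k\<close> times the partial sum. At \<open>k = d\<close> the latter is 0.\<close>

lemma abel_sum_nonneg:
  fixes c \<delta> :: "nat \<Rightarrow> real"
  assumes c: "antimono_on {1..d} c"
    and partial: "\<And>k. k \<le> d \<Longrightarrow> 0 \<le> (\<Sum>i\<in>{1..k}. \<delta> i)"
    and total: "(\<Sum>i\<in>{1..d}. \<delta> i) = 0"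
  shows "0 \<le> (\<Sum>i\<in>{1..d}. c i * \<delta> i)"
proof -
  have "c k * (\<Sum>i\<in>{1..k}. \<delta> i) \<le> (\<Sum>i\<in>{1..k}. c i * \<delta> i)" if "k \<le> d" for k
    using that
  proof (induction k)
    case (Suc k)
    have "c (Suc k) * (\<Sum>i\<in>{1..k}. \<delta> i) \<le> c k * (\<Sum>i\<in>{1..k}. \<delta> i)"
    proof (cases "k = 0")
      case False
      then show ?thesis
        using Suc.prems partial[of k] by (intro mult_right_mono monotone_onD[OF c]) auto
    qed simp
    then show ?case using Suc by (simp add: distrib_left)
  qed simp
  from this[of d] show ?thesis by (simp only: total) simp
qed

section \<open>The norm given by the eigenvalues\<close>

context hyperbolic
begin

abbreviation "nrm \<equiv> norm_p d p e"

lemma norm_p_sq: "(nrm x)\<^sup>2 = (\<Sum>i\<in>{1..d}. (ev x i)\<^sup>2)"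
  unfolding norm_p_def L2_set_def by (simp add: sum_nonneg)

lemma norm_p_nonneg: "0 \<le> nrm x"
  unfolding norm_p_def by (rule L2_set_nonneg)

text \<open>Subadditivity for \<open>k = d\<close>, applied to \<open>x\<close>, \<open>y\<close>
  and to \<open>- x\<close>, \<open>- y\<close>; negation changes the sign of the trace, so the
  second inequality is the reverse of the first.\<close>

lemma trace_additive:
  "(\<Sum>i\<in>{1..d}. ev (x + y) i) = (\<Sum>i\<in>{1..d}. ev x i) + (\<Sum>i\<in>{1..d}. ev y i)"
proof (rule antisym)
  have minus: "(\<Sum>i\<in>{1..d}. ev (- z) i) = - (\<Sum>i\<in>{1..d}. ev z i)" for z
    unfolding eigenvalues_minus sum_negf[symmetric]
    by (rule sum.reindex_bij_witness[of _ "\<lambda>i. Suc d - i" "\<lambda>i. Suc d - i"]) auto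
  have "(\<Sum>i\<in>{1..d}. ev (- x + - y) i) \<le> (\<Sum>i\<in>{1..d}. ev (- x) i) + (\<Sum>i\<in>{1..d}. ev (- y) i)"
    by (rule sum_largest_eigenvalues_subadditive) simp
  moreover have "- x + - y = - (x + y)" by simp
  ultimately show "(\<Sum>i\<in>{1..d}. ev x i) + (\<Sum>i\<in>{1..d}. ev y i) \<le> (\<Sum>i\<in>{1..d}. ev (x + y) i)"
    using minus by (simp only:)
qed (rule sum_largest_eigenvalues_subadditive, simp)

text \<open>The vector \<open>?z\<close> is majorised by \<open>?w\<close>, so Abel summation with
  weights \<open>?z\<close> bounds its squared norm by the inner product of \<open>?z\<close> and
  \<open>?w\<close>. The Cauchy-Schwarz inequality finishes the proof.\<close>

lemma norm_p_add_le: "nrm (x + y) \<le> L2_set (\<lambda>i. ev x i + ev y i) {1..d}"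
proof -
  let ?z = "ev (x + y)" and ?w = "\<lambda>i. ev x i + ev y i"
  have "0 \<le> (\<Sum>i\<in>{1..d}. ?z i * (?w i - ?z i))"
  proof (rule abel_sum_nonneg[OF antimono_eigenvalues])
    show "0 \<le> (\<Sum>i\<in>{1..k}. ?w i - ?z i)" if "k \<le> d" for k
      using sum_largest_eigenvalues_subadditive[OF that, of x y]
      by (simp add: sum_subtractf sum.distrib)
    show "(\<Sum>i\<in>{1..d}. ?w i - ?z i) = 0"
      using trace_additive[of x y] by (simp add: sum_subtractf sum.distrib)
  qed
  then have "(nrm (x + y))\<^sup>2 \<le> (\<Sum>i\<in>{1..d}. ?z i * ?w i)"
    unfolding norm_p_sq by (simp add: right_diff_distrib sum_subtractf power2_eq_square)
  also have "\<dots> \<le> (\<Sum>i\<in>{1..d}. \<bar>?z i\<bar> * \<bar>?w i\<bar>)"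
    by (intro sum_mono) (simp flip: abs_mult)
  also have "\<dots> \<le> nrm (x + y) * L2_set ?w {1..d}"
    unfolding norm_p_def by (rule L2_set_mult_ineq)
  finally have *: "nrm (x + y) * nrm (x + y) \<le> nrm (x + y) * L2_set ?w {1..d}"
    by (simp add: power2_eq_square)
  show ?thesis
  proof (cases "nrm (x + y) = 0")
    case False
    then have "0 < nrm (x + y)" using norm_p_nonneg[of "x + y"] by simp
    then show ?thesis using * by (simp add: mult_le_cancel_left_pos)
  qed (simp add: L2_set_nonneg)
qed

text \<open>The squared norm of \<open>x + s y\<close> is a power sum, hence a polynomial in
  \<open>s\<close>. Its growth shows that it is at most quadratic with \<open>s^2\<close>
  coefficient \<open>(nrm y)^2\<close>; the values at 0, 1 and -1 give the law.\<close>

lemma norm_p_parallelogram: "(nrm (x + y))\<^sup>2 + (nrm (x - y))\<^sup>2 = 2 * (nrm x)\<^sup>2 + 2 * (nrm y)\<^sup>2"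
proof -
  obtain R where "pencil d (\<lambda>s. ev (x + s *\<^sub>R y)) R" using pencil by blast
  then obtain Q where "\<And>s. (\<Sum>i\<in>{1..d}. ev (x + s *\<^sub>R y) i ^ 2) = poly Q s"
    using pencil.power_sum_poly by blast
  then have Q: "poly Q s = (nrm (x + s *\<^sub>R y))\<^sup>2" for s by (simp add: norm_p_sq)
  have "((\<lambda>s. \<Sum>i\<in>{1..d}. (ev (x + s *\<^sub>R y) i / s)\<^sup>2) \<longlongrightarrow> (\<Sum>i\<in>{1..d}. (ev y i)\<^sup>2)) at_top"
    by (intro tendsto_intros tendsto_eigenvalue_at_top)
  then have "((\<lambda>s. poly Q s / s ^ 2) \<longlongrightarrow> (nrm y)\<^sup>2) at_top"
    by (simp add: Q norm_p_sq sum_divide_distrib power_divide)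
  then have Q2: "degree Q \<le> 2" "coeff Q 2 = (nrm y)\<^sup>2" by (rule poly_growth)+
  have "poly Q s = coeff Q 0 + coeff Q 1 * s + (nrm y)\<^sup>2 * s\<^sup>2" for s
  proof -
    have "poly Q s = (\<Sum>i\<le>2. coeff Q i * s ^ i)"
      unfolding poly_altdef using Q2(1) by (intro sum.mono_neutral_left) (auto simp: coeff_eq_0)
    then show ?thesis using Q2(2) by (simp add: numeral_2_eq_2)
  qed
  from this[of 0] this[of 1] this[of "- 1"] show ?thesis by (simp add: Q)
qed

text \<open>The Euclidean parallelogram law for the two eigenvalue vectors has the same right-hand
  side as \<open>norm_p_parallelogram\<close>, so the upper bound for sums becomes a lower bound for
  differences.\<close>

lemma norm_p_diff_ge: "L2_set (\<lambda>i. ev x i - ev y i) {1..d} \<le> nrm (x - y)"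
  and norm_p_diff_eq:
    "ev (x + y) = (\<lambda>i. ev x i + ev y i) \<Longrightarrow> nrm (x - y) = L2_set (\<lambda>i. ev x i - ev y i) {1..d}"
proof -
  let ?D = "L2_set (\<lambda>i. ev x i - ev y i) {1..d}" and ?S = "L2_set (\<lambda>i. ev x i + ev y i) {1..d}"
  have "?D\<^sup>2 + ?S\<^sup>2 = (\<Sum>i\<in>{1..d}. 2 * (ev x i)\<^sup>2 + 2 * (ev y i)\<^sup>2)"
    by (simp add: L2_set_def sum_nonneg sum.distrib[symmetric])
       (auto intro!: sum.cong simp: power2_eq_square algebra_simps)
  also have "\<dots> = 2 * (nrm x)\<^sup>2 + 2 * (nrm y)\<^sup>2"
    by (simp add: norm_p_sq sum.distrib sum_distrib_left)
  finally have D: "(nrm (x - y))\<^sup>2 - ?D\<^sup>2 = ?S\<^sup>2 - (nrm (x + y))\<^sup>2"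
    using norm_p_parallelogram[of x y] by simp
  have "(nrm (x + y))\<^sup>2 \<le> ?S\<^sup>2"
    using norm_p_add_le norm_p_nonneg by (intro power_mono) auto
  then have "?D\<^sup>2 \<le> (nrm (x - y))\<^sup>2" using D by simp
  then show "?D \<le> nrm (x - y)"
    by (rule power2_le_imp_le) (rule norm_p_nonneg)
  assume "ev (x + y) = (\<lambda>i. ev x i + ev y i)"
  then have "nrm (x + y) = ?S" by (simp add: norm_p_def)
  then have "(nrm (x - y))\<^sup>2 = ?D\<^sup>2" using D by simp
  then show "nrm (x - y) = ?D"
    using norm_p_nonneg L2_set_nonneg by (metis power2_eq_imp_eq)
qed

text \<open>Makes the infima range over nonempty sets. Doubling fixes the zero vector and doubles
  its eigenvalues, so they vanish.\<close>

lemma zero_in_hyperbolicity_cone: "0 \<in> hyperbolicity_cone d p e"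
proof -
  have "ev (2 *\<^sub>R 0) = (\<lambda>i. 2 * ev 0 i)" by (rule eigenvalues_scale) simp
  then have "ev 0 d = 2 * ev 0 d" by (metis scaleR_zero_right)
  then show ?thesis by (simp add: hyperbolicity_cone_def)
qed

theorem dist_hyperbolicity_cone:
  assumes "isometric_polynomial d p e"
  shows "dist_p d p e x (hyperbolicity_cone d p e) =
    (INF u\<in>ev ` hyperbolicity_cone d p e. L2_set (\<lambda>i. ev x i - u i) {1..d})"
  unfolding dist_p_def image_image
proof (rule antisym)
  let ?\<Lambda> = "hyperbolicity_cone d p e"
  have nonempty: "?\<Lambda> \<noteq> {}" using zero_in_hyperbolicity_cone by blast
  show "(INF y\<in>?\<Lambda>. nrm (x - y)) \<le> (INF z\<in>?\<Lambda>. L2_set (\<lambda>i. ev x i - ev z i) {1..d})"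
  proof (rule cINF_mono[OF nonempty])
    show "bdd_below ((\<lambda>y. nrm (x - y)) ` ?\<Lambda>)"
      by (rule bdd_belowI[of _ 0]) (auto simp: norm_p_nonneg)
    fix z assume z: "z \<in> ?\<Lambda>"
    \<comment> \<open>Isometry replaces \<open>z\<close> by a point with the same eigenvalues, hence
      still in the cone, for which \<open>norm_p_diff_eq\<close> applies.\<close>
    obtain y where y: "ev y = ev z" "ev (y + x) = (\<lambda>i. ev y i + ev x i)"
      using assms unfolding isometric_polynomial_def by blast
    then have "nrm (x - y) = L2_set (\<lambda>i. ev x i - ev y i) {1..d}"
      by (intro norm_p_diff_eq) (simp add: add.commute)
    moreover have "y \<in> ?\<Lambda>" using z y(1) by (simp add: hyperbolicity_cone_def)
    ultimately show "\<exists>y\<in>?\<Lambda>. nrm (x - y) \<le> L2_set (\<lambda>i. ev x i - ev z i) {1..d}"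
      using y(1) by (intro bexI[of _ y]) auto
  qed
  show "(INF z\<in>?\<Lambda>. L2_set (\<lambda>i. ev x i - ev z i) {1..d}) \<le> (INF y\<in>?\<Lambda>. nrm (x - y))"
  proof (rule cINF_mono[OF nonempty])
    show "bdd_below ((\<lambda>z. L2_set (\<lambda>i. ev x i - ev z i) {1..d}) ` ?\<Lambda>)"
      by (rule bdd_belowI[of _ 0]) (auto simp: L2_set_nonneg)
  qed (use norm_p_diff_ge in blast)
qed

text \<open>The infimum is attained at the positive part of \<open>ev x\<close>, which is again
  decreasing. It is optimal in every coordinate separately.\<close>

lemma L2_dist_nonneg_decreasing_vectors:
  "(INF u\<in>nonneg_orthant d \<inter> decreasing_vectors d. L2_set (\<lambda>i. ev x i - u i) {1..d})
    = L2_set (\<lambda>i. min (ev x i) 0) {1..d}"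
proof (rule cInf_eq_minimum)
  let ?u = "\<lambda>i. max (ev x i) 0"
  have "antimono_on {1..d} ?u"
    using antimono_eigenvalues[of x] by (fastforce simp: monotone_on_def)
  then have "?u \<in> nonneg_orthant d \<inter> decreasing_vectors d"
    using eigenvalues_outside[of _ x] by (auto simp: nonneg_orthant_def decreasing_vectors_def vectors_def)
  moreover have "min (ev x i) 0 = ev x i - ?u i" for i by (simp add: max_def min_def)
  ultimately show "L2_set (\<lambda>i. min (ev x i) 0) {1..d}
      \<in> (\<lambda>u. L2_set (\<lambda>i. ev x i - u i) {1..d}) ` (nonneg_orthant d \<inter> decreasing_vectors d)"
    by (intro image_eqI[of _ _ ?u]) simp_all
next
  fix r assume "r \<in> (\<lambda>u. L2_set (\<lambda>i. ev x i - u i) {1..d}) ` (nonneg_orthant d \<inter> decreasing_vectors d)"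
  then obtain u where u: "u \<in> nonneg_orthant d \<inter> decreasing_vectors d"
    and r: "r = L2_set (\<lambda>i. ev x i - u i) {1..d}" by blast
  show "L2_set (\<lambda>i. min (ev x i) 0) {1..d} \<le> r"
    unfolding r L2_set_def
  proof (intro real_sqrt_le_mono sum_mono)
    fix i assume "i \<in> {1..d}"
    then have "0 \<le> u i" using u by (simp add: nonneg_orthant_def)
    then show "(min (ev x i) 0)\<^sup>2 \<le> (ev x i - u i)\<^sup>2"
      unfolding abs_le_square_iff[symmetric] by linarith
  qed
qed

end

theorem proposition3p4:
  fixes p :: "real ^ 'n \<Rightarrow> real" and e x :: "real ^ 'n" and d :: nat
  assumes "hyperbolic_polynomial d p e"
    and "complete_polynomial d p e"
    and "isometric_polynomial d p e"
  shows "dist_p d p e x (hyperbolicity_cone d p e) =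
           (INF u\<in>eigenvalues d p e ` hyperbolicity_cone d p e.
              L2_set (\<lambda>i. eigenvalues d p e x i - u i) {1..d}) \<and>
         (eigenvalues d p e ` hyperbolicity_cone d p e = nonneg_orthant d \<inter> decreasing_vectors d
            \<longrightarrow> (dist_p d p e x (hyperbolicity_cone d p e))\<^sup>2 =
                  (\<Sum>i=1..d. (min (eigenvalues d p e x i) 0)\<^sup>2))"
proof -
  interpret hyperbolic d p e by unfold_locales (rule assms(1))
  show ?thesis
    using dist_hyperbolicity_cone[OF assms(3), of x] L2_dist_nonneg_decreasing_vectors[of x]
    by (simp add: L2_set_def sum_nonneg)
qed

end
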